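(* Let $\pi_0$ be an irreducible representation of $G(V_0)$, $\tau$ an irreducible representation of $\mathrm{GL}_{\mathbb E}(X)$, and $\rho=\mathrm{Ind}_P^{G(V)}(\tau\boxtimes\pi_0)$ (possibly reducible). If $\chi^{1+q}\ne1$, then the operator $J(\rho,\chi)=|\mathfrak g_V|^{-1/2}\sum_{g\in G^0(V),\,\det(\mathrm{id}+g)\ne0}\chi(\det(\mathrm{id}_V+g))\rho(g)$ is a scalar operator on $\rho$.
   Context: Let $\mathbb F$ be a finite field of odd cardinality $q$, $\mathbb E/\mathbb F$ of degree $1$ or $2$ with Galois generator $x\mapsto\bar x$; $\mathcal C$ algebraically closed of characteristic not dividing $q$, with fixed $\sqrt q$. $(V,\langle\cdot,\cdot\rangle_V)$ is an $\epsilon$-sesquilinear space over $\mathbb E$ ($\mathbb E$-linear in the first variable, $\langle y,x\rangle=\epsilon_V\overline{\langle x,y\rangle}$, $\epsilon_V=1$ if $\mathbb E\neq\mathbb F$), nondegenerate or with zero form; $G(V)$ its isometry group, $\mathfrak g_V$ its Lie algebra $\{A:\langle Ax,y\rangle+\langle x,Ay\rangle=0\}$; $G^0(V)=\{\det=1\}$ if $\mathbb E=\mathbb F$, $\epsilon_V=1$, nondegenerate, else $G^0(V)=G(V)$. For $\chi:\mathbb E^\times\to\mathcal C^\times$, $\chi^{1+q}(x)=\chi(x\bar x)$. Parabolic setup: if the form is nondegenerate, $V=X\oplus V_0\oplus Y$ with $X,Y$ totally isotropic in duality, $V_0=(X\oplus Y)^\perp$, and $P$ the stabilizer in $G(V)$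 of $0\subset X\subset X\oplus V_0\subset V$ (Levi $\mathrm{GL}(X)\times G(V_0)$); if the form is zero, $V=X\oplus V_0$ and $P$ the stabilizer of $X$ in $\mathrm{GL}(V)$ (Levi $\mathrm{GL}(X)\times\mathrm{GL}(V_0)$). $\mathrm{Ind}$ denotes parabolic induction. *)

theory Defs
  imports "Jordan_Normal_Form.Determinant" "HOL-Computational_Algebra.Polynomial"
begin

text \<open>The field E is a finite field type with an involutive field automorphism conj
 (the Galois generator of E/F; conj = id iff E = F).  F is its fixed field and
 q = |F|.\<close>

definition fixed_field :: "('e::field \<Rightarrow> 'e) \<Rightarrow> 'e set" where
  "fixed_field cj = {x. cj x = x}"

definition qF :: "('e::field \<Rightarrow> 'e) \<Rightarrow> nat" where
  "qF cj = card (fixed_field cj)"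

definition galois_setup :: "('e::{field,finite} \<Rightarrow> 'e) \<Rightarrow> bool" where
  "galois_setup cj \<longleftrightarrow>
     (\<forall>x y. cj (x + y) = cj x + cj y) \<and> (\<forall>x y. cj (x * y) = cj x * cj y) \<and>
     cj 1 = 1 \<and> (\<forall>x. cj (cj x) = x) \<and> odd (qF cj)"

definition alg_closed :: "'c::field itself \<Rightarrow> bool" where
  "alg_closed _ \<longleftrightarrow> (\<forall>p :: 'c poly. degree p > 0 \<longrightarrow> (\<exists>x. poly p x = 0))"

text \<open>A character chi of E^x with values in C^x (values at 0 are irrelevant).\<close>
definition character :: "('e::field \<Rightarrow> 'c::field) \<Rightarrow> bool" where
  "character chi \<longleftrightarrow> (\<forall>x. x \<noteq> 0 \<longrightarrow> chi x \<noteq> 0) \<and>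
     (\<forall>x y. x \<noteq> 0 \<longrightarrow> y \<noteq> 0 \<longrightarrow> chi (x * y) = chi x * chi y)"

definition sesq :: "('e::field \<Rightarrow> 'e) \<Rightarrow> 'e mat \<Rightarrow> 'e vec \<Rightarrow> 'e vec \<Rightarrow> 'e" where
  "sesq cj M x y = (\<Sum>i<dim_row M. \<Sum>j<dim_row M. x $ i * M $$ (i, j) * cj (y $ j))"

definition eps_sesq :: "('e::field \<Rightarrow> 'e) \<Rightarrow> 'e \<Rightarrow> nat \<Rightarrow> 'e mat \<Rightarrow> bool" where
  "eps_sesq cj eps n M \<longleftrightarrow> M \<in> carrier_mat n n \<and> (eps = 1 \<or> eps = -1) \<and>
     (cj \<noteq> id \<longrightarrow> eps = 1) \<and>
     (\<forall>i<n. \<forall>j<n. M $$ (j, i) = eps * cj (M $$ (i, j)))"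

definition nondeg :: "'e::field mat \<Rightarrow> bool" where
  "nondeg M \<longleftrightarrow> det M \<noteq> 0"

text \<open>Isometry group G(V) (for the zero form this is GL(V)).\<close>
definition isom_group :: "('e::field \<Rightarrow> 'e) \<Rightarrow> nat \<Rightarrow> 'e mat \<Rightarrow> 'e mat set" where
  "isom_group cj n M = {g \<in> carrier_mat n n. det g \<noteq> 0 \<and>
     (\<forall>x \<in> carrier_vec n. \<forall>y \<in> carrier_vec n. sesq cj M (g *\<^sub>v x) (g *\<^sub>v y) = sesq cj M x y)}"

definition lie_alg :: "('e::field \<Rightarrow> 'e) \<Rightarrow> nat \<Rightarrow> 'e mat \<Rightarrow> 'e mat set" where
  "lie_alg cj n M = {A \<in> carrier_mat n n.
     (\<forall>x \<in> carrier_vec n. \<forall>y \<in> carrier_vec n. sesq cj M (A *\<^sub>v x) y + sesq cj M x (A *\<^sub>v y) = 0)}"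

definition isom_group0 :: "('e::field \<Rightarrow> 'e) \<Rightarrow> 'e \<Rightarrow> nat \<Rightarrow> 'e mat \<Rightarrow> 'e mat set" where
  "isom_group0 cj eps n M =
     (if cj = id \<and> eps = 1 \<and> nondeg M then {g \<in> isom_group cj n M. det g = 1}
      else isom_group cj n M)"

definition is_subspace :: "nat \<Rightarrow> 'c::field vec set \<Rightarrow> bool" where
  "is_subspace d W \<longleftrightarrow> W \<subseteq> carrier_vec d \<and> 0\<^sub>v d \<in> W \<and>
     (\<forall>v \<in> W. \<forall>w \<in> W. v + w \<in> W) \<and> (\<forall>a. \<forall>v \<in> W. a \<cdot>\<^sub>v v \<in> W)"

definition is_rep :: "nat \<Rightarrow> 'e::field mat set \<Rightarrow> nat \<Rightarrow> ('e mat \<Rightarrow> 'c::field mat) \<Rightarrow> bool" where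
  "is_rep n H d r \<longleftrightarrow> (\<forall>g \<in> H. r g \<in> carrier_mat d d) \<and> r (1\<^sub>m n) = 1\<^sub>m d \<and>
     (\<forall>g \<in> H. \<forall>h \<in> H. r (g * h) = r g * r h)"

definition irrep :: "nat \<Rightarrow> 'e::field mat set \<Rightarrow> nat \<Rightarrow> ('e mat \<Rightarrow> 'c::field mat) \<Rightarrow> bool" where
  "irrep n H d r \<longleftrightarrow> is_rep n H d r \<and> d > 0 \<and>
     (\<forall>W. is_subspace d W \<longrightarrow> (\<forall>g \<in> H. \<forall>w \<in> W. r g *\<^sub>v w \<in> W) \<longrightarrow>
          W = {0\<^sub>v d} \<or> W = carrier_vec d)"

definition kron :: "'c::semiring_0 mat \<Rightarrow> 'c mat \<Rightarrow> 'c mat" where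
  "kron A B = mat (dim_row A * dim_row B) (dim_col A * dim_col B)
     (\<lambda>(i, j). A $$ (i div dim_row B, j div dim_col B) * B $$ (i mod dim_row B, j mod dim_col B))"

text \<open>V = E^n with coordinates adapted to V = X + V0 + Y (nondegenerate case,
 n = k + m + k) resp. V = X + V0 (zero form, n = k + m): indices < k span X,
 indices in [k, k+m) span V0, indices >= k+m span Y.\<close>

definition blk :: "nat \<Rightarrow> nat \<Rightarrow> nat \<Rightarrow> nat" where
  "blk k m i = (if i < k then 0 else if i < k + m then 1 else 2)"

definition parabolic_setup :: "('e::field \<Rightarrow> 'e) \<Rightarrow> 'e \<Rightarrow> nat \<Rightarrow> nat \<Rightarrow> nat \<Rightarrow> 'e mat \<Rightarrow> bool" where
  "parabolic_setup cj eps k m n M \<longleftrightarrow> eps_sesq cj eps n M \<and>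
     ((n = k + m + k \<and> nondeg M \<and>
       \<comment> \<open>X and Y totally isotropic, V0 orthogonal to X + Y\<close>
       (\<forall>i<n. \<forall>j<n. (blk k m i = 0 \<and> blk k m j = 0) \<or> (blk k m i = 2 \<and> blk k m j = 2)
            \<or> (blk k m i = 1 \<and> blk k m j \<noteq> 1) \<or> (blk k m i \<noteq> 1 \<and> blk k m j = 1)
            \<longrightarrow> M $$ (i, j) = 0))
      \<or> (n = k + m \<and> M = 0\<^sub>m n n))"

text \<open>Stabilizer P of the flag 0 < X < X + V0 < V in G(V) (zero form: of X in GL(V)).\<close>
definition parabolic :: "('e::field \<Rightarrow> 'e) \<Rightarrow> nat \<Rightarrow> nat \<Rightarrow> nat \<Rightarrow> 'e mat \<Rightarrow> 'e mat set" where
  "parabolic cj k m n M = {p \<in> isom_group cj n M.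
     \<forall>i<n. \<forall>j<n. blk k m i > blk k m j \<longrightarrow> p $$ (i, j) = 0}"

definition levi_X :: "nat \<Rightarrow> 'e mat \<Rightarrow> 'e mat" where
  "levi_X k p = mat k k (\<lambda>(i, j). p $$ (i, j))"

definition levi_0 :: "nat \<Rightarrow> nat \<Rightarrow> 'e mat \<Rightarrow> 'e mat" where
  "levi_0 k m p = mat m m (\<lambda>(i, j). p $$ (k + i, k + j))"

definition gram0 :: "nat \<Rightarrow> nat \<Rightarrow> 'e mat \<Rightarrow> 'e mat" where
  "gram0 k m M = levi_0 k m M"

text \<open>The induced representation Ind_P^G(tau x pi0): functions f on G(V) with values in
 C^(dt*d0) = C^dt (x) C^d0 such that f(p g) = (tau x pi0)(p) f(g); G(V) acts by
 right translation, (rho(g) f)(h) = f(h g).\<close>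
definition ind_space ::
  "('e::field \<Rightarrow> 'e) \<Rightarrow> nat \<Rightarrow> nat \<Rightarrow> nat \<Rightarrow> 'e mat \<Rightarrow> nat \<Rightarrow> ('e mat \<Rightarrow> 'c::field mat)
     \<Rightarrow> nat \<Rightarrow> ('e mat \<Rightarrow> 'c mat) \<Rightarrow> ('e mat \<Rightarrow> 'c vec) set" where
  "ind_space cj k m n M dt tau d0 pi0 = {f.
     (\<forall>g \<in> isom_group cj n M. f g \<in> carrier_vec (dt * d0)) \<and>
     (\<forall>p \<in> parabolic cj k m n M. \<forall>g \<in> isom_group cj n M.
        f (p * g) = kron (tau (levi_X k p)) (pi0 (levi_0 k m p)) *\<^sub>v f g)}"

text \<open>|g_V|^(1/2), using the fixed square root sq of q: |g_V| = q^e, |g_V|^(1/2) = sq^e.\<close>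
definition half_size :: "('e::{field,finite} \<Rightarrow> 'e) \<Rightarrow> nat \<Rightarrow> 'e mat \<Rightarrow> 'c::field \<Rightarrow> 'c" where
  "half_size cj n M sq = sq ^ (THE e. card (lie_alg cj n M) = qF cj ^ e)"

definition J_op ::
  "('e::{field,finite} \<Rightarrow> 'e) \<Rightarrow> 'e \<Rightarrow> nat \<Rightarrow> 'e mat \<Rightarrow> 'c::field \<Rightarrow> ('e \<Rightarrow> 'c) \<Rightarrow> nat
     \<Rightarrow> ('e mat \<Rightarrow> 'c vec) \<Rightarrow> ('e mat \<Rightarrow> 'c vec)" where
  "J_op cj eps n M sq chi d f = (\<lambda>h. vec d (\<lambda>i. inverse (half_size cj n M sq) *
     (\<Sum>g \<in> {g \<in> isom_group0 cj eps n M. det (1\<^sub>m n + g) \<noteq> 0}.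
        chi (det (1\<^sub>m n + g)) * (f (h * g)) $ i)))"

end

theory Submission
  imports Defs "Jordan_Normal_Form.Char_Poly"
begin

text \<open>
  Put \<open>\<phi>(g) = \<chi>(det (1 + g))\<close> on \<open>G\<^sup>0\<close>, extended by zero. As \<open>\<phi>\<close> is a class function, up to the normalising
  constant J maps f to \<open>h \<mapsto> \<Sum>\<^sub>g \<phi>(g) f(g h)\<close>. The part of this sum over the parabolic P is \<open>T f(h)\<close> with
  \<open>T = \<Sum>\<^sub>p \<phi>(p) (\<tau> \<otimes> \<pi>\<^sub>0)(p)\<close>, which commutes with the Levi subgroup and hence is a scalar by Schur's lemma.

  The rest splits into cosets \<open>U g\<close> of the unipotent radical U, on which f is constant, so it suffices that
  \<open>\<Sum>\<^sub>u \<phi>(g u) = 0\<close> for g outside P. If \<open>1 + g\<close> is invertible, put \<open>b = g (1 + g)\<^sup>-\<^sup>1\<close>; its adjoint is \<open>1 - b\<close>, and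
  b does not map X to itself. Hence there is an elementary c with image in X, killing X, such that
  \<open>det (1 + b c)\<close> is any prescribed \<open>x \<noteq> 0\<close>. With d the adjoint of c and \<open>u = 1 + N\<close>,
  \<open>(1 + b c) (1 + b N) (1 - b d) = 1 + b N'\<close> where \<open>u \<mapsto> 1 + N'\<close> is a permutation of U. As
  \<open>1 + g u = (1 + g) (1 + b N)\<close>, this permutation multiplies \<open>det (1 + g u)\<close> by \<open>x cj(x)\<close>, so the sum is
  invariant under multiplication by \<open>\<chi>(x cj(x))\<close> and vanishes.
\<close>

text \<open>The obstacle is the form. Multiplying \<open>1 + b N\<close> on the left by
  \<open>1 + b c\<close> scales the determinant by any prescribed nonzero factor and keeps the
  unipotent shape of \<open>1 + N\<close>, but the result need not come from an isometry. The factor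
  \<open>1 - b d\<close> on the right is the correction that restores this, thanks to the
  adjointness of \<open>b\<close> and \<open>1 - b\<close>. Its determinant turns out to be the
  conjugate of the first one, which is why the scaling factors are norms x cj(x) and why the
  hypothesis concerns \<open>chi\<close> composed with the norm. For the zero form \<open>d\<close>
  is 0, nothing has to be corrected, and the left factor is given the whole norm. The determinant of
  the right factor is found by passing to its adjoint \<open>1 - c (1 - b)\<close>, which splits as
  \<open>(1 - c) (1 + c b)\<close> because \<open>c\<close> has square zero.\<close>

section \<open>Matrix algebra\<close>

text \<open>Read \<open>d\<close>, \<open>1 - b\<close>, \<open>N2\<close> as adjoints of
  \<open>c\<close>, \<open>b\<close>, \<open>N\<close>. Then the second factor is the adjoint of the
  first, and the identity says that the modified element is an isometry if \<open>1 + N\<close> is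
  one, which is the content of \<open>n2\<close>. An abstract ring leaves a pure computation with
  noncommutative words.\<close>

lemma (in ring) unit_perturbation:
  assumes car: "c \<in> carrier R" "d \<in> carrier R" "b \<in> carrier R" "N \<in> carrier R" "N2 \<in> carrier R"
    and rel: "c \<otimes> c = \<zero>" "N \<otimes> c = \<zero>" "d \<otimes> c = \<zero>" "d \<otimes> d = \<zero>" "d \<otimes> N2 = \<zero>"
    and n2: "N \<otimes> N2 = \<ominus> N \<ominus> N2"
  shows "(\<one> \<oplus> (((\<one> \<oplus> c \<otimes> b) \<otimes> N \<oplus> c) \<otimes> (\<one> \<ominus> b \<otimes> d) \<ominus> d)) \<otimes>
    (\<one> \<oplus> ((\<one> \<ominus> c \<otimes> (\<one> \<ominus> b)) \<otimes> (N2 \<otimes> (\<one> \<oplus> (\<one> \<ominus> b) \<otimes> d) \<oplus> d) \<ominus> c)) = \<one>"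
proof -
  \<comment> \<open>The monomials that are left after applying the relations occur in opposite
    pairs: \<open>S\<close> collects one sign, \<open>T\<close> the other.\<close>
  define S where "S = N \<oplus> N2 \<oplus> c \<oplus> N \<otimes> (b \<otimes> d) \<oplus> c \<otimes> (b \<otimes> N) \<oplus> c \<otimes> (b \<otimes> N2) \<oplus> c \<otimes> (b \<otimes> d)
    \<oplus> c \<otimes> (N2 \<otimes> (b \<otimes> d)) \<oplus> c \<otimes> (b \<otimes> (N2 \<otimes> d))"
  define T where "T = \<ominus> N \<oplus> \<ominus> N2 \<oplus> \<ominus> c \<oplus> \<ominus> (N \<otimes> (b \<otimes> d)) \<oplus> \<ominus> (c \<otimes> (b \<otimes> N))
    \<oplus> \<ominus> (c \<otimes> (b \<otimes> N2)) \<oplus> \<ominus> (c \<otimes> (b \<otimes> d)) \<oplus> \<ominus> (c \<otimes> (N2 \<otimes> (b \<otimes> d)))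
    \<oplus> \<ominus> (c \<otimes> (b \<otimes> (N2 \<otimes> d)))"
  have "T = \<ominus> S" using car by (simp add: S_def T_def minus_add)
  then have ST: "S \<oplus> T = \<zero>" using car by (simp add: S_def r_neg)
  \<comment> \<open>The relations again with a trailing factor, so that they fire inside
    right-associated products.\<close>
  have L: "c \<otimes> (c \<otimes> y) = \<zero>" "N \<otimes> (c \<otimes> y) = \<zero>" "d \<otimes> (c \<otimes> y) = \<zero>" "d \<otimes> (d \<otimes> y) = \<zero>"
    "d \<otimes> (N2 \<otimes> y) = \<zero>" "N \<otimes> (N2 \<otimes> y) = (\<ominus> N \<ominus> N2) \<otimes> y" if "y \<in> carrier R" for y
    using car rel n2 that by (simp_all flip: m_assoc)
  have ST': "\<one> \<oplus> (S \<oplus> T) = \<one>" unfolding ST by simp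
  show ?thesis
    using car
    apply (simp add: ring_simprules rel n2 L)
    apply (rule trans[OF _ ST'])
    apply (simp add: S_def T_def a_assoc a_comm a_lcomm)
    done
qed

text \<open>Collapse from the left: the first two factors give \<open>1 + b K\<close> with
  \<open>K = (1 + c b) N + c\<close>, and the third turns this into
  \<open>1 + b (K (1 - b d) - d)\<close>. The cofactor of \<open>b\<close> is exactly the
  perturbation of \<open>unit_perturbation\<close>.\<close>

lemma (in ring) perturbation_factorization:
  assumes "c \<in> carrier R" "d \<in> carrier R" "b \<in> carrier R" "N \<in> carrier R"
  shows "(\<one> \<oplus> b \<otimes> c) \<otimes> (\<one> \<oplus> b \<otimes> N) \<otimes> (\<one> \<ominus> b \<otimes> d)
    = \<one> \<oplus> b \<otimes> (((\<one> \<oplus> c \<otimes> b) \<otimes> N \<oplus> c) \<otimes> (\<one> \<ominus> b \<otimes> d) \<ominus> d)"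
  using assms by (simp add: ring_simprules)

text \<open>With \<open>a_minus_ring_mat\<close>, this lets identities proved in the ring locale be
  read with the usual matrix operations.\<close>

lemma a_inv_ring_mat:
  assumes "A \<in> carrier_mat n n"
  shows "a_inv (ring_mat TYPE('a::comm_ring_1) n ()) A = - A"
proof -
  interpret R: ring "ring_mat TYPE('a) n ()" by (rule ring_mat)
  have "- A \<oplus>\<^bsub>ring_mat TYPE('a) n ()\<^esub> A = \<zero>\<^bsub>ring_mat TYPE('a) n ()\<^esub>"
    using assms by (simp add: ring_mat_simps uminus_l_inv_mat)
  then show ?thesis
    using assms R.minus_equality[of "- A" A] by (simp add: ring_mat_simps)
qed

lemma a_minus_ring_mat:
  assumes "A \<in> carrier_mat n n" "B \<in> carrier_mat n n"
  shows "A \<ominus>\<^bsub>ring_mat TYPE('a::comm_ring_1) n ()\<^esub> B = A - B"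
  using assms by (simp add: a_minus_def a_inv_ring_mat ring_mat_simps minus_add_uminus_mat[of _ n n])

lemma mat_unit_perturbation:
  fixes b :: "'a::comm_ring_1 mat"
  assumes car: "c \<in> carrier_mat n n" "d \<in> carrier_mat n n" "b \<in> carrier_mat n n"
      "N \<in> carrier_mat n n" "N2 \<in> carrier_mat n n"
    and rel: "c * c = 0\<^sub>m n n" "N * c = 0\<^sub>m n n" "d * c = 0\<^sub>m n n" "d * d = 0\<^sub>m n n" "d * N2 = 0\<^sub>m n n"
    and n2: "N * N2 = - N - N2"
  shows "(1\<^sub>m n + (((1\<^sub>m n + c * b) * N + c) * (1\<^sub>m n - b * d) - d)) *
    (1\<^sub>m n + ((1\<^sub>m n - c * (1\<^sub>m n - b)) * (N2 * (1\<^sub>m n + (1\<^sub>m n - b) * d) + d) - c)) = 1\<^sub>m n"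
proof -
  interpret R: ring "ring_mat TYPE('a) n ()" by (rule ring_mat)
  show ?thesis
    using R.unit_perturbation[of c d b N N2] assms
    by (simp add: ring_mat_simps a_minus_ring_mat a_inv_ring_mat minus_carrier_mat mult_carrier_mat[of _ n n _ n] del: assoc_mult_mat)
qed

lemma mat_perturbation_factorization:
  fixes b :: "'a::comm_ring_1 mat"
  assumes "c \<in> carrier_mat n n" "d \<in> carrier_mat n n" "b \<in> carrier_mat n n" "N \<in> carrier_mat n n"
  shows "(1\<^sub>m n + b * c) * (1\<^sub>m n + b * N) * (1\<^sub>m n - b * d)
    = 1\<^sub>m n + b * (((1\<^sub>m n + c * b) * N + c) * (1\<^sub>m n - b * d) - d)"
proof -
  interpret R: ring "ring_mat TYPE('a) n ()" by (rule ring_mat)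
  show ?thesis
    using R.perturbation_factorization[of c d b N] assms
    by (simp add: ring_mat_simps a_minus_ring_mat minus_carrier_mat mult_carrier_mat[of _ n n _ n] del: assoc_mult_mat)
qed

section \<open>Finiteness, inverses and determinants of matrices\<close>

lemma finite_carrier_mat: "finite (carrier_mat r c :: 'a::finite mat set)"
proof (rule finite_subset)
  show "carrier_mat r c \<subseteq> mat r c ` (({..<r} \<times> {..<c}) \<rightarrow>\<^sub>E (UNIV :: 'a set))"
  proof
    fix A :: "'a mat" assume A: "A \<in> carrier_mat r c"
    have "A = mat r c (restrict (\<lambda>ij. A $$ ij) ({..<r} \<times> {..<c}))"
      using A by (intro eq_matI) auto
    moreover have "restrict (\<lambda>ij. A $$ ij) ({..<r} \<times> {..<c}) \<in> ({..<r} \<times> {..<c}) \<rightarrow>\<^sub>E UNIV"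
      by (rule restrict_PiE_iff[THEN iffD2]) simp
    ultimately show "A \<in> mat r c ` (({..<r} \<times> {..<c}) \<rightarrow>\<^sub>E (UNIV :: 'a set))" by (rule image_eqI)
  qed
  show "finite (mat r c ` (({..<r} \<times> {..<c}) \<rightarrow>\<^sub>E (UNIV :: 'a set)))"
    by (intro finite_imageI finite_PiE) auto
qed

lemma det_nonzero_obtain_inverse:
  fixes A :: "'a::field mat"
  assumes "A \<in> carrier_mat n n" "det A \<noteq> 0"
  obtains B where "B \<in> carrier_mat n n" "A * B = 1\<^sub>m n" "B * A = 1\<^sub>m n" "det B \<noteq> 0"
proof -
  from det_non_zero_imp_unit[OF assms, of "()"] obtain B where
    B: "B \<in> carrier_mat n n" "A * B = 1\<^sub>m n" "B * A = 1\<^sub>m n"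
    by (auto simp: Units_def ring_mat_simps)
  have "det A * det B = 1" using B(2) det_mult[OF assms(1) B(1)] by simp
  then have "det B \<noteq> 0" by auto
  with B show thesis by (rule that)
qed

lemma mult_one_imp_det_nonzero:
  fixes A :: "'a::field mat"
  assumes "A \<in> carrier_mat n n" "B \<in> carrier_mat n n" "A * B = 1\<^sub>m n"
  shows "det A \<noteq> 0"
  using det_mult[OF assms(1,2)] assms(3) by auto

lemma mult_left_cancel_mat:
  fixes A :: "'a::field mat"
  assumes "A \<in> carrier_mat n n" "det A \<noteq> 0" "B \<in> carrier_mat n l" "C \<in> carrier_mat n l" "A * B = A * C"
  shows "B = C"
proof -
  obtain A' where A': "A' \<in> carrier_mat n n" "A' * A = 1\<^sub>m n"
    using det_nonzero_obtain_inverse[OF assms(1,2)] by metis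
  have "B = A' * (A * B)" using A' assms(1,3) by (simp flip: assoc_mult_mat[of A' n n A n B l])
  also have "\<dots> = C" unfolding assms(5) using A' assms(1,4) by (simp flip: assoc_mult_mat[of A' n n A n C l])
  finally show ?thesis .
qed

lemma mult_right_cancel_mat:
  fixes A :: "'a::field mat"
  assumes "A \<in> carrier_mat n n" "det A \<noteq> 0" "B \<in> carrier_mat l n" "C \<in> carrier_mat l n" "B * A = C * A"
  shows "B = C"
proof -
  obtain A' where A': "A' \<in> carrier_mat n n" "A * A' = 1\<^sub>m n"
    using det_nonzero_obtain_inverse[OF assms(1,2)] by metis
  have "B = (B * A) * A'" using A' assms(1,3,4) by simp
  also have "\<dots> = C" unfolding assms(5) using A' assms(1,3,4) by simp
  finally show ?thesis .
qed

text \<open>Left translation by \<open>A\<close> is injective, hence onto by finiteness, so it hits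
  the identity. The isometry group, the stabilizer of X and P thus get inverses from closure under
  products alone.\<close>

lemma finite_mat_monoid_inverse:
  fixes H :: "'a::field mat set"
  assumes fin: "finite H" and H: "H \<subseteq> {A \<in> carrier_mat n n. det A \<noteq> 0}" and one: "1\<^sub>m n \<in> H"
    and mult: "\<And>A B. A \<in> H \<Longrightarrow> B \<in> H \<Longrightarrow> A * B \<in> H"
    and A: "A \<in> H" and B: "B \<in> carrier_mat n n" "A * B = 1\<^sub>m n"
  shows "B \<in> H"
proof -
  have car: "C \<in> carrier_mat n n" "det C \<noteq> 0" if "C \<in> H" for C using H that by auto
  have "inj_on ((*) A) H"
  proof (rule inj_onI)
    fix B C assume "B \<in> H" "C \<in> H" "A * B = A * C"
    then show "B = C" using mult_left_cancel_mat[of A n B n C] car A by blast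
  qed
  moreover have "(*) A ` H \<subseteq> H" using mult A by auto
  ultimately have "(*) A ` H = H" by (simp add: endo_inj_surj fin)
  then obtain C where C: "C \<in> H" "A * C = 1\<^sub>m n" using one by (metis imageE)
  have "C = B" using mult_left_cancel_mat[of A n C n B] car A B C by simp
  with C show ?thesis by simp
qed

text \<open>The product of \<open>b\<close> with an elementary matrix has one nonzero column, so the
  sum is the identity with column \<open>q\<close> replaced, and Cramer's rule reads off the
  determinant. If \<open>b $$ (q, p)\<close> is nonzero, a suitable \<open>t\<close> yields any
  prescribed value.\<close>

lemma det_one_plus_column:
  fixes b :: "'a::comm_ring_1 mat"
  assumes b: "b \<in> carrier_mat n n" and pq: "p < n" "q < n"
  shows "det (1\<^sub>m n + b * mat n n (\<lambda>(i, j). if i = p \<and> j = q then t else 0)) = 1 + t * b $$ (q, p)"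
proof -
  let ?x = "unit_vec n q + t \<cdot>\<^sub>v col b p"
  have x: "?x \<in> carrier_vec n" using b pq by auto
  have "1\<^sub>m n + b * mat n n (\<lambda>(i, j). if i = p \<and> j = q then t else 0) = replace_col (1\<^sub>m n) (1\<^sub>m n *\<^sub>v ?x) q"
  proof (rule eq_matI)
    fix i j assume ij: "i < dim_row (replace_col (1\<^sub>m n) (1\<^sub>m n *\<^sub>v ?x) q)"
      "j < dim_col (replace_col (1\<^sub>m n) (1\<^sub>m n *\<^sub>v ?x) q)"
    then have ij: "i < n" "j < n" by (auto simp: replace_col_def)
    have "(\<Sum>l = 0..<n. b $$ (i, l) * (if l = p \<and> j = q then t else 0))
      = (\<Sum>l = 0..<n. if l = p then (if j = q then t * b $$ (i, p) else 0) else 0)"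
      by (rule sum.cong) (auto simp: mult.commute)
    also have "\<dots> = (if j = q then t * b $$ (i, p) else 0)" using pq by (simp add: sum.delta)
    finally have "(b * mat n n (\<lambda>(i, j). if i = p \<and> j = q then t else 0)) $$ (i, j)
      = (if j = q then t * b $$ (i, p) else 0)"
      using b pq ij by (simp add: scalar_prod_def)
    then show "(1\<^sub>m n + b * mat n n (\<lambda>(i, j). if i = p \<and> j = q then t else 0)) $$ (i, j)
      = replace_col (1\<^sub>m n) (1\<^sub>m n *\<^sub>v ?x) q $$ (i, j)"
      using b pq ij x by (auto simp: replace_col_def simp del: index_mult_mat(1))
  qed (use b in \<open>auto simp: replace_col_def\<close>)
  then show ?thesis using cramer_lemma_mat[of "1\<^sub>m n" n ?x q] b pq x by simp
qed

lemma smult_mat_cancel: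
  fixes a :: "'a::field"
  assumes "a \<noteq> 0" "a \<cdot>\<^sub>m A = a \<cdot>\<^sub>m B"
  shows "A = B"
proof (rule eq_matI)
  show d: "dim_row A = dim_row B" "dim_col A = dim_col B"
    using arg_cong[OF assms(2), of dim_row] arg_cong[OF assms(2), of dim_col] by simp_all
  fix i j assume ij: "i < dim_row B" "j < dim_col B"
  have "(a \<cdot>\<^sub>m A) $$ (i, j) = (a \<cdot>\<^sub>m B) $$ (i, j)" by (simp only: assms(2))
  then show "A $$ (i, j) = B $$ (i, j)" using ij d assms(1) by simp
qed

lemma mult_mat_index_lessThan:
  assumes "A \<in> carrier_mat a b" "B \<in> carrier_mat b c" "i < a" "j < c"
  shows "(A * B) $$ (i, j) = (\<Sum>l<b. A $$ (i, l) * B $$ (l, j))"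
  using assms by (simp add: scalar_prod_def atLeast0LessThan)

lemma mult_mat_zero_col:
  fixes A :: "'a::semiring_0 mat"
  assumes "A \<in> carrier_mat n n" "B \<in> carrier_mat n n" "i < n" "j < n" "\<And>l. l < n \<Longrightarrow> B $$ (l, j) = 0"
  shows "(A * B) $$ (i, j) = 0"
  using assms by (simp add: mult_mat_index_lessThan[of _ n n] del: index_mult_mat(1))

lemma mult_mat_zero_row:
  fixes A :: "'a::semiring_0 mat"
  assumes "A \<in> carrier_mat n n" "B \<in> carrier_mat n n" "i < n" "j < n" "\<And>l. l < n \<Longrightarrow> A $$ (i, l) = 0"
  shows "(A * B) $$ (i, j) = 0"
  using assms by (simp add: mult_mat_index_lessThan[of _ n n] del: index_mult_mat(1))

lemma mult_mat_zero_terms: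
  fixes A :: "'a::semiring_0 mat"
  assumes "A \<in> carrier_mat n n" "B \<in> carrier_mat n n" "i < n" "j < n"
    and "\<And>l. l < n \<Longrightarrow> A $$ (i, l) = 0 \<or> B $$ (l, j) = 0"
  shows "(A * B) $$ (i, j) = 0"
proof -
  have "(\<Sum>l<n. A $$ (i, l) * B $$ (l, j)) = 0"
  proof (rule sum.neutral, rule ballI)
    fix l assume "l \<in> {..<n}"
    then show "A $$ (i, l) * B $$ (l, j) = 0" using assms(5)[of l] by auto
  qed
  then show ?thesis using assms(1-4) by (simp add: mult_mat_index_lessThan[of _ n n] del: index_mult_mat(1))
qed

lemma minus_right_cancel_mat:
  fixes A :: "'a::ab_group_add mat"
  assumes "A \<in> carrier_mat n n" "B \<in> carrier_mat n n" "C \<in> carrier_mat n n" "A - C = B - C"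
  shows "A = B"
proof (rule eq_matI)
  fix i j assume "i < dim_row B" "j < dim_col B"
  then have ij: "i < n" "j < n" using assms by auto
  have "(A - C) $$ (i, j) = (B - C) $$ (i, j)" by (simp only: assms(4))
  then show "A $$ (i, j) = B $$ (i, j)" using ij assms(1-3) by simp
qed (use assms in auto)

lemma add_right_cancel_mat:
  fixes A :: "'a::ab_group_add mat"
  assumes "A \<in> carrier_mat n n" "B \<in> carrier_mat n n" "C \<in> carrier_mat n n" "A + C = B + C"
  shows "A = B"
proof (rule eq_matI)
  fix i j assume "i < dim_row B" "j < dim_col B"
  then have ij: "i < n" "j < n" using assms by auto
  have "(A + C) $$ (i, j) = (B + C) $$ (i, j)" by (simp only: assms(4))
  then show "A $$ (i, j) = B $$ (i, j)" using ij assms(1-3) by simp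
qed (use assms in auto)

lemma one_plus_cancel_mat:
  fixes A :: "'a::comm_ring_1 mat"
  assumes "A \<in> carrier_mat n n" "B \<in> carrier_mat n n" "1\<^sub>m n + A = 1\<^sub>m n + B"
  shows "A = B"
  using add_right_cancel_mat[of A n B "1\<^sub>m n"] assms by (simp add: comm_add_mat[of _ n n])

lemma inj_on_mat_left_mult:
  fixes H :: "'a::field mat set"
  assumes H: "H \<subseteq> {A \<in> carrier_mat n n. det A \<noteq> 0}" and l: "l \<in> carrier_mat n n" "det l \<noteq> 0"
  shows "inj_on (\<lambda>p. l * p) H"
proof (rule inj_onI)
  fix p q assume "p \<in> H" "q \<in> H" "l * p = l * q"
  moreover from this have "p \<in> carrier_mat n n" "q \<in> carrier_mat n n" using H by auto
  ultimately show "p = q" using mult_left_cancel_mat[OF l, of p n q] by blast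
qed

lemma inj_on_mat_right_mult:
  fixes H :: "'a::field mat set"
  assumes H: "H \<subseteq> {A \<in> carrier_mat n n. det A \<noteq> 0}" and l: "l \<in> carrier_mat n n" "det l \<noteq> 0"
  shows "inj_on (\<lambda>p. p * l) H"
proof (rule inj_onI)
  fix p q assume "p \<in> H" "q \<in> H" "p * l = q * l"
  moreover from this have "p \<in> carrier_mat n n" "q \<in> carrier_mat n n" using H by auto
  ultimately show "p = q" using mult_right_cancel_mat[OF l, of p n q] by blast
qed

lemma finite_mat_monoid_translate:
  fixes H :: "'a::field mat set"
  assumes fin: "finite H" and H: "H \<subseteq> {A \<in> carrier_mat n n. det A \<noteq> 0}"
    and mult: "\<And>A B. A \<in> H \<Longrightarrow> B \<in> H \<Longrightarrow> A * B \<in> H" and l: "l \<in> H"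
  shows "bij_betw (\<lambda>p. l * p) H H" "bij_betw (\<lambda>p. p * l) H H"
proof -
  have lc: "l \<in> carrier_mat n n" "det l \<noteq> 0" using H l by auto
  show "bij_betw (\<lambda>p. l * p) H H"
    unfolding bij_betw_def using inj_on_mat_left_mult[OF H lc] mult l
    by (auto intro!: endo_inj_surj[OF fin])
  show "bij_betw (\<lambda>p. p * l) H H"
    unfolding bij_betw_def using inj_on_mat_right_mult[OF H lc] mult l
    by (auto intro!: endo_inj_surj[OF fin])
qed

lemma sum_mid:
  fixes f :: "nat \<Rightarrow> 'a::comm_monoid_add"
  assumes "k + m \<le> n"
  shows "(\<Sum>i<n. if k \<le> i \<and> i < k + m then f i else 0) = (\<Sum>i<m. f (k + i))"
proof -
  have "(\<Sum>i<n. if k \<le> i \<and> i < k + m then f i else 0) = (\<Sum>i\<in>{k..<k + m}. f i)"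
    using assms by (intro sum.mono_neutral_cong_right) auto
  also have "\<dots> = (\<Sum>i<m. f (k + i))"
    by (rule sum.reindex_bij_witness[of _ "\<lambda>i. k + i" "\<lambda>i. i - k"]) auto
  finally show ?thesis .
qed

section \<open>Matrices that differ from the identity in one diagonal block\<close>

definition embed_block :: "nat \<Rightarrow> nat \<Rightarrow> nat \<Rightarrow> 'a::zero_neq_one mat \<Rightarrow> 'a mat" where
  "embed_block n lo d a = mat n n (\<lambda>(i, j). if lo \<le> i \<and> i < lo + d \<and> lo \<le> j \<and> j < lo + d
     then a $$ (i - lo, j - lo) else if i = j then 1 else 0)"

lemma embed_block_carrier [simp]: "embed_block n lo d a \<in> carrier_mat n n"
  by (simp add: embed_block_def)

lemma embed_block_one: "embed_block n lo d (1\<^sub>m d) = 1\<^sub>m n"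
  by (intro eq_matI) (auto simp: embed_block_def)

text \<open>\<open>x\<close> is a function rather than a vector, so that the formula serves both for
  columns of a second block matrix and for coordinates of a vector.\<close>

lemma embed_block_mult_vec:
  fixes a :: "'a::comm_ring_1 mat"
  assumes le: "lo + d \<le> n" and a: "a \<in> carrier_mat d d" and i: "i < n"
  shows "(\<Sum>l<n. embed_block n lo d a $$ (i, l) * x l)
    = (if lo \<le> i \<and> i < lo + d then (\<Sum>l<d. a $$ (i - lo, l) * x (lo + l)) else x i)"
proof (cases "lo \<le> i \<and> i < lo + d")
  case True
  have "(\<Sum>l<n. embed_block n lo d a $$ (i, l) * x l)
    = (\<Sum>l<n. if lo \<le> l \<and> l < lo + d then a $$ (i - lo, l - lo) * x l else 0)"
    using True i by (intro sum.cong) (auto simp: embed_block_def)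
  then show ?thesis using True by (simp add: sum_mid[OF le])
next
  case False
  have "(\<Sum>l<n. embed_block n lo d a $$ (i, l) * x l) = (\<Sum>l<n. if l = i then x l else 0)"
    using False i by (intro sum.cong) (auto simp: embed_block_def)
  then show ?thesis using False i by (simp only: sum.delta finite_lessThan if_False lessThan_iff if_True)
qed

lemma embed_block_mult:
  fixes a :: "'a::comm_ring_1 mat"
  assumes le: "lo + d \<le> n" and a: "a \<in> carrier_mat d d" and a': "a' \<in> carrier_mat d d"
  shows "embed_block n lo d (a * a') = embed_block n lo d a * embed_block n lo d a'"
proof (rule eq_matI)
  fix i j assume "i < dim_row (embed_block n lo d a * embed_block n lo d a')"
    "j < dim_col (embed_block n lo d a * embed_block n lo d a')"
  then have ij: "i < n" "j < n" by (auto simp: embed_block_def)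
  have "(embed_block n lo d a * embed_block n lo d a') $$ (i, j)
    = (\<Sum>l<n. embed_block n lo d a $$ (i, l) * embed_block n lo d a' $$ (l, j))"
    using ij by (intro mult_mat_index_lessThan[of _ n n _ n]) auto
  also have "\<dots> = (if lo \<le> i \<and> i < lo + d then (\<Sum>l<d. a $$ (i - lo, l) * embed_block n lo d a' $$ (lo + l, j))
      else embed_block n lo d a' $$ (i, j))"
    by (rule embed_block_mult_vec[OF le a ij(1)])
  also have "\<dots> = embed_block n lo d (a * a') $$ (i, j)"
  proof (cases "lo \<le> i \<and> i < lo + d")
    case i: True
    show ?thesis
    proof (cases "lo \<le> j \<and> j < lo + d")
      case True
      have "embed_block n lo d (a * a') $$ (i, j) = (a * a') $$ (i - lo, j - lo)"
        using i True ij by (simp add: embed_block_def del: index_mult_mat(1))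
      also have "\<dots> = (\<Sum>l<d. a $$ (i - lo, l) * a' $$ (l, j - lo))"
        using i True by (intro mult_mat_index_lessThan[OF a a']) auto
      also have "\<dots> = (\<Sum>l<d. a $$ (i - lo, l) * embed_block n lo d a' $$ (lo + l, j))"
        using True ij le by (intro sum.cong) (auto simp: embed_block_def)
      finally show ?thesis using i by simp
    next
      case False
      then have "(\<Sum>l<d. a $$ (i - lo, l) * embed_block n lo d a' $$ (lo + l, j)) = 0"
        using ij le by (intro sum.neutral) (auto simp: embed_block_def)
      moreover have "embed_block n lo d (a * a') $$ (i, j) = 0"
        using i False ij by (auto simp: embed_block_def simp del: index_mult_mat(1))
      ultimately show ?thesis using i by simp
    qed
  next
    case False
    then show ?thesis using ij by (auto simp: embed_block_def)
  qed
  finally show "embed_block n lo d (a * a') $$ (i, j) = (embed_block n lo d a * embed_block n lo d a') $$ (i, j)" by simp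
qed (auto simp: embed_block_def)

lemma embed_block_det:
  fixes a :: "'a::field mat"
  assumes le: "lo + d \<le> n" and a: "a \<in> carrier_mat d d" "det a \<noteq> 0"
  shows "det (embed_block n lo d a) \<noteq> 0"
proof -
  obtain a' where a': "a' \<in> carrier_mat d d" "a * a' = 1\<^sub>m d" using det_nonzero_obtain_inverse[OF a] by metis
  have "embed_block n lo d a * embed_block n lo d a' = 1\<^sub>m n"
    using embed_block_mult[OF le a(1) a'(1)] a'(2) by (simp add: embed_block_one)
  then show ?thesis by (intro mult_one_imp_det_nonzero[of _ n "embed_block n lo d a'"]) auto
qed

section \<open>Kronecker products and Schur's lemma\<close>

text \<open>Algebraic closedness provides an eigenvalue of \<open>T\<close>; the eigenspace is
  stable under \<open>r\<close>, so irreducibility makes it the whole space.\<close>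

lemma schur_scalar:
  fixes r :: "'e::field mat \<Rightarrow> 'c::field mat"
  assumes alg: "alg_closed TYPE('c)" and irr: "irrep n H d r" and T: "T \<in> carrier_mat d d"
    and comm: "\<And>g. g \<in> H \<Longrightarrow> T * r g = r g * T"
  shows "\<exists>c. T = c \<cdot>\<^sub>m 1\<^sub>m d"
proof -
  have d: "d > 0" and r: "\<And>g. g \<in> H \<Longrightarrow> r g \<in> carrier_mat d d"
    and sub: "\<And>W. is_subspace d W \<Longrightarrow> (\<And>g w. g \<in> H \<Longrightarrow> w \<in> W \<Longrightarrow> r g *\<^sub>v w \<in> W) \<Longrightarrow>
          W = {0\<^sub>v d} \<or> W = carrier_vec d"
    using irr unfolding irrep_def is_rep_def by blast+
  have "degree (char_poly T) > 0" using degree_monic_char_poly[OF T] d by simp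
  then obtain c where "poly (char_poly T) c = 0" using alg unfolding alg_closed_def by blast
  then obtain v where v: "v \<in> carrier_vec d" "v \<noteq> 0\<^sub>v d" "T *\<^sub>v v = c \<cdot>\<^sub>v v"
    using eigenvalue_root_char_poly[OF T, of c] T unfolding eigenvalue_def eigenvector_def by auto
  let ?W = "{w \<in> carrier_vec d. T *\<^sub>v w = c \<cdot>\<^sub>v w}"
  have "is_subspace d ?W"
    using T unfolding is_subspace_def
    by (auto simp: mult_add_distrib_mat_vec[of _ d d] smult_add_distrib_vec[of _ d] mult_mat_vec[of _ d d]
        smult_smult_assoc mult.commute)
  moreover have "r g *\<^sub>v w \<in> ?W" if "g \<in> H" "w \<in> ?W" for g w
  proof -
    have "T *\<^sub>v (r g *\<^sub>v w) = (T * r g) *\<^sub>v w"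
      using T r[OF that(1)] that(2) by (simp add: assoc_mult_mat_vec[of T d d "r g" d])
    also have "\<dots> = r g *\<^sub>v (T *\<^sub>v w)"
      using T r[OF that(1)] that(2) comm[OF that(1)] by (simp add: assoc_mult_mat_vec[of "r g" d d T d])
    also have "\<dots> = c \<cdot>\<^sub>v (r g *\<^sub>v w)"
      using r[OF that(1)] that(2) by (simp add: mult_mat_vec[of _ d d])
    finally show ?thesis using r[OF that(1)] that(2) by auto
  qed
  ultimately have "?W = {0\<^sub>v d} \<or> ?W = carrier_vec d" by (rule sub)
  then have W: "?W = carrier_vec d" using v by blast
  have "T = c \<cdot>\<^sub>m 1\<^sub>m d"
  proof (rule eq_matI)
    fix i j assume "i < dim_row (c \<cdot>\<^sub>m 1\<^sub>m d)" "j < dim_col (c \<cdot>\<^sub>m 1\<^sub>m d)"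
    then have ij: "i < d" "j < d" by auto
    have "unit_vec d j \<in> ?W" unfolding W by simp
    then have "(T *\<^sub>v unit_vec d j) $ i = (c \<cdot>\<^sub>v unit_vec d j) $ i" by simp
    then show "T $$ (i, j) = (c \<cdot>\<^sub>m 1\<^sub>m d) $$ (i, j)" using T ij by simp
  qed (use T in auto)
  then show ?thesis by blast
qed

lemma sum_div_mod:
  fixes f :: "nat \<Rightarrow> 'a::comm_monoid_add"
  shows "(\<Sum>l = 0..<a * b. f l) = (\<Sum>i<a. \<Sum>j<b. f (i * b + j))"
proof -
  have "(\<Sum>l = 0..<a * b. f l) = (\<Sum>i<a. sum f {i * b..<i * b + b})"
    by (simp add: sum.nat_group atLeast0LessThan)
  also have "\<dots> = (\<Sum>i<a. \<Sum>j<b. f (i * b + j))"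
  proof (rule sum.cong[OF refl])
    fix i show "sum f {i * b..<i * b + b} = (\<Sum>j<b. f (i * b + j))"
      by (rule sum.reindex_bij_witness[of _ "\<lambda>j. i * b + j" "\<lambda>l. l - i * b"]) auto
  qed
  finally show ?thesis .
qed

lemma block_index_less: "i < a \<Longrightarrow> j < b \<Longrightarrow> i * b + j < a * (b::nat)"
proof -
  assume "i < a" "j < b"
  then have "i * b + j < Suc i * b" by simp
  also have "\<dots> \<le> a * b" using \<open>i < a\<close> by (intro mult_le_mono1) simp
  finally show ?thesis .
qed

lemma block_index_cases:
  assumes "l < a * (b::nat)"
  obtains i j where "i < a" "j < b" "l = i * b + j"
proof -
  have b: "b > 0" using assms by (cases b) auto
  then show thesis using that[of "l div b" "l mod b"] assms by (simp add: less_mult_imp_div_less)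
qed

text \<open>A tensor index is the pair \<open>i * b + j\<close> with \<open>i\<close> from the first
  factor; equalities of operators on a tensor product are checked in this form.\<close>

lemma eq_block_matI:
  assumes "X \<in> carrier_mat (a * b) (a * b)" "Y \<in> carrier_mat (a * b) (a * b)"
    and "\<And>i j i' j'. i < a \<Longrightarrow> j < b \<Longrightarrow> i' < a \<Longrightarrow> j' < b \<Longrightarrow>
      X $$ (i * b + j, i' * b + j') = Y $$ (i * b + j, i' * b + j')"
  shows "X = Y"
proof (rule eq_matI)
  fix l l' assume "l < dim_row Y" "l' < dim_col Y"
  then have "l < a * b" "l' < a * b" using assms by auto
  then show "X $$ (l, l') = Y $$ (l, l')"
    by (elim block_index_cases) (simp add: assms(3))
qed (use assms in auto)

lemma kron_carrier [simp]:
  "A \<in> carrier_mat a a \<Longrightarrow> B \<in> carrier_mat b b \<Longrightarrow> kron A B \<in> carrier_mat (a * b) (a * b)"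
  by (auto simp: kron_def)

lemma kron_index:
  assumes "A \<in> carrier_mat a a" "B \<in> carrier_mat b b" "i < a" "j < b" "i' < a" "j' < b"
  shows "kron A B $$ (i * b + j, i' * b + j') = A $$ (i, i') * B $$ (j, j')"
  using assms block_index_less[of i a j b] block_index_less[of i' a j' b]
  by (auto simp: kron_def)

lemma mult_block_index:
  fixes X Y :: "'a::semiring_0 mat"
  assumes "X \<in> carrier_mat (a * b) (a * b)" "Y \<in> carrier_mat (a * b) (a * b)"
    and "i < a" "j < b" "i' < a" "j' < b"
  shows "(X * Y) $$ (i * b + j, i' * b + j') =
    (\<Sum>l<a. \<Sum>p<b. X $$ (i * b + j, l * b + p) * Y $$ (l * b + p, i' * b + j'))"
  using assms block_index_less[of i a j b] block_index_less[of i' a j' b] block_index_less[of _ a _ b]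
  by (simp add: scalar_prod_def sum_div_mod)

lemma kron_mult:
  fixes A :: "'a::comm_semiring_1 mat"
  assumes "A \<in> carrier_mat a a" "A' \<in> carrier_mat a a" "B \<in> carrier_mat b b" "B' \<in> carrier_mat b b"
  shows "kron (A * A') (B * B') = kron A B * kron A' B'"
proof (rule eq_block_matI)
  fix i j i' j' assume ij: "i < a" "j < b" "i' < a" "j' < b"
  have "(A * A') $$ (i, i') * (B * B') $$ (j, j')
    = (\<Sum>l<a. \<Sum>p<b. A $$ (i, l) * A' $$ (l, i') * (B $$ (j, p) * B' $$ (p, j')))"
    using assms ij by (simp add: mult_mat_index_lessThan[of _ a a] mult_mat_index_lessThan[of _ b b] sum_product del: index_mult_mat(1))
  also have "\<dots> = (kron A B * kron A' B') $$ (i * b + j, i' * b + j')"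
    using assms ij by (simp add: mult_block_index[of _ a b] kron_index[of _ a _ b] del: index_mult_mat(1)) (simp add: mult_ac)
  finally show "kron (A * A') (B * B') $$ (i * b + j, i' * b + j') = (kron A B * kron A' B') $$ (i * b + j, i' * b + j')"
    using assms ij by (simp add: kron_index[of _ a _ b] del: index_mult_mat(1))
qed (use assms mult_carrier_mat[OF kron_carrier[of A a B b] kron_carrier[of A' a B' b]] in auto)

lemma block_index_eq_iff:
  assumes "j < b" "j' < (b::nat)"
  shows "i * b + j = i' * b + j' \<longleftrightarrow> i = i' \<and> j = j'"
proof
  assume eq: "i * b + j = i' * b + j'"
  have "(i * b + j) div b = i" "(i' * b + j') div b = i'" using assms by auto
  then have "i = i'" using eq by metis
  then show "i = i' \<and> j = j'" using eq by simp
qed simp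

lemma kron_one: "kron (1\<^sub>m a) (1\<^sub>m b) = (1\<^sub>m (a * b) :: 'a::semiring_1 mat)"
proof (rule eq_block_matI[of _ a b])
  fix i j i' j' assume "i < a" "j < b" "i' < a" "j' < b"
  then show "kron (1\<^sub>m a) (1\<^sub>m b) $$ (i * b + j, i' * b + j') = (1\<^sub>m (a * b) :: 'a mat) $$ (i * b + j, i' * b + j')"
    by (simp add: kron_index[of _ a _ b] block_index_less block_index_eq_iff)
qed auto

lemma sum_mult_delta_right:
  fixes x :: "nat \<Rightarrow> 'a::comm_semiring_1"
  assumes "j < b"
  shows "(\<Sum>p<b. x p * (c * (if p = j then 1 else 0))) = x j * c"
proof -
  have "(\<Sum>p<b. x p * (c * (if p = j then 1 else 0))) = (\<Sum>p<b. if p = j then x p * c else 0)"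
    by (rule sum.cong) auto
  then show ?thesis using assms by simp
qed

lemma sum_mult_delta_left:
  fixes x :: "nat \<Rightarrow> 'a::comm_semiring_1"
  assumes "j < b"
  shows "(\<Sum>p<b. c * (if j = p then 1 else 0) * x p) = c * x j"
proof -
  have "(\<Sum>p<b. c * (if j = p then 1 else 0) * x p) = (\<Sum>p<b. if j = p then c * x p else 0)"
    by (rule sum.cong) auto
  then show ?thesis using assms by simp
qed

text \<open>Applying Schur's lemma twice avoids showing that the external tensor product is
  irreducible. Fixing the second-factor indices of \<open>T\<close> leaves an operator on the first
  factor commuting with \<open>r1\<close>, hence a scalar. These scalars form a matrix
  \<open>S\<close> with \<open>T\<close> equal to the identity tensor \<open>S\<close>, and
  commutation with \<open>r2\<close> makes \<open>S\<close> scalar.\<close>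

lemma schur_scalar_kron:
  fixes r1 r2 :: "'e::field mat \<Rightarrow> 'c::field mat"
  assumes alg: "alg_closed TYPE('c)" and irr1: "irrep n1 H1 a r1" and irr2: "irrep n2 H2 b r2"
    and T: "T \<in> carrier_mat (a * b) (a * b)"
    and comm1: "\<And>g. g \<in> H1 \<Longrightarrow> T * kron (r1 g) (1\<^sub>m b) = kron (r1 g) (1\<^sub>m b) * T"
    and comm2: "\<And>h. h \<in> H2 \<Longrightarrow> T * kron (1\<^sub>m a) (r2 h) = kron (1\<^sub>m a) (r2 h) * T"
  shows "\<exists>c. T = c \<cdot>\<^sub>m 1\<^sub>m (a * b)"
proof -
  have a: "a > 0" and r1: "\<And>g. g \<in> H1 \<Longrightarrow> r1 g \<in> carrier_mat a a"
    using irr1 unfolding irrep_def is_rep_def by simp_all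
  have r2: "\<And>g. g \<in> H2 \<Longrightarrow> r2 g \<in> carrier_mat b b"
    using irr2 unfolding irrep_def is_rep_def by simp
  \<comment> \<open>Slices with stride \<open>b\<close>, since the second-factor index runs fastest
    in \<open>kron\<close>.\<close>
  define D where "D j j' = mat a a (\<lambda>(i, i'). T $$ (i * b + j, i' * b + j'))" for j j'
  have D: "D j j' \<in> carrier_mat a a" for j j' by (simp add: D_def)
  have "\<exists>c. D j j' = c \<cdot>\<^sub>m 1\<^sub>m a" if jj: "j < b" "j' < b" for j j'
  proof (rule schur_scalar[OF alg irr1 D])
    fix g assume g: "g \<in> H1"
    show "D j j' * r1 g = r1 g * D j j'"
    proof (rule eq_matI)
      fix i i' assume "i < dim_row (r1 g * D j j')" "i' < dim_col (r1 g * D j j')"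
      then have i: "i < a" "i' < a" using r1[OF g] D[of j j'] by auto
      have "(D j j' * r1 g) $$ (i, i') = (\<Sum>l<a. T $$ (i * b + j, l * b + j') * r1 g $$ (l, i'))"
        using i r1[OF g] D[of j j'] by (simp add: mult_mat_index_lessThan[of _ a a] del: index_mult_mat(1)) (simp add: D_def)
      also have "\<dots> = (\<Sum>l<a. \<Sum>p<b. T $$ (i * b + j, l * b + p) * kron (r1 g) (1\<^sub>m b) $$ (l * b + p, i' * b + j'))"
        using i jj r1[OF g] by (intro sum.cong) (simp_all add: kron_index[of _ a _ b] sum_mult_delta_right)
      also have "\<dots> = (T * kron (r1 g) (1\<^sub>m b)) $$ (i * b + j, i' * b + j')"
        using i jj r1[OF g] T by (simp add: mult_block_index[of _ a b] del: index_mult_mat(1))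
      also have "\<dots> = (kron (r1 g) (1\<^sub>m b) * T) $$ (i * b + j, i' * b + j')" by (simp only: comm1[OF g])
      also have "\<dots> = (\<Sum>l<a. \<Sum>p<b. kron (r1 g) (1\<^sub>m b) $$ (i * b + j, l * b + p) * T $$ (l * b + p, i' * b + j'))"
        using i jj r1[OF g] T by (simp add: mult_block_index[of _ a b] del: index_mult_mat(1))
      also have "\<dots> = (\<Sum>l<a. r1 g $$ (i, l) * T $$ (l * b + j, i' * b + j'))"
        using i jj r1[OF g] by (intro sum.cong) (simp_all add: kron_index[of _ a _ b] sum_mult_delta_left)
      also have "\<dots> = (r1 g * D j j') $$ (i, i')"
        using i r1[OF g] D[of j j'] by (simp add: mult_mat_index_lessThan[of _ a a] del: index_mult_mat(1)) (simp add: D_def)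
      finally show "(D j j' * r1 g) $$ (i, i') = (r1 g * D j j') $$ (i, i')" .
    qed (use r1[OF g] D[of j j'] in auto)
  qed
  then obtain s where s: "\<And>j j'. j < b \<Longrightarrow> j' < b \<Longrightarrow> D j j' = s j j' \<cdot>\<^sub>m 1\<^sub>m a" by metis
  define S where "S = mat b b (\<lambda>(j, j'). s j j')"
  have S: "S \<in> carrier_mat b b" by (simp add: S_def)
  have TS: "T = kron (1\<^sub>m a) S"
  proof (rule eq_block_matI[OF T])
    fix i j i' j' assume ij: "i < a" "j < b" "i' < a" "j' < b"
    have "T $$ (i * b + j, i' * b + j') = D j j' $$ (i, i')" using ij by (simp add: D_def)
    also have "\<dots> = kron (1\<^sub>m a) S $$ (i * b + j, i' * b + j')"
      using ij S by (simp add: s kron_index[of _ a _ b]) (simp add: S_def)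
    finally show "T $$ (i * b + j, i' * b + j') = kron (1\<^sub>m a) S $$ (i * b + j, i' * b + j')" .
  qed (use S in simp)
  have "\<exists>c. S = c \<cdot>\<^sub>m 1\<^sub>m b"
  proof (rule schur_scalar[OF alg irr2 S])
    fix h assume h: "h \<in> H2"
    have eq: "kron (1\<^sub>m a) (S * r2 h) = kron (1\<^sub>m a) (r2 h * S)"
      using comm2[OF h] S r2[OF h] kron_mult[of "1\<^sub>m a" a "1\<^sub>m a" S b "r2 h"] kron_mult[of "1\<^sub>m a" a "1\<^sub>m a" "r2 h" b S]
      by (simp add: TS)
    show "S * r2 h = r2 h * S"
    proof (rule eq_matI)
      fix j j' assume "j < dim_row (r2 h * S)" "j' < dim_col (r2 h * S)"
      then have j: "j < b" "j' < b" using r2[OF h] S by auto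
      \<comment> \<open>Entries are read off at first-factor indices 0, which exist because
        \<open>a > 0\<close>.\<close>
      show "(S * r2 h) $$ (j, j') = (r2 h * S) $$ (j, j')"
        using arg_cong[OF eq, of "\<lambda>X. X $$ (0 * b + j, 0 * b + j')"]
          kron_index[of "1\<^sub>m a" a "S * r2 h" b 0 j 0 j'] kron_index[of "1\<^sub>m a" a "r2 h * S" b 0 j 0 j'] a j S r2[OF h]
        by (simp del: index_mult_mat(1))
    qed (use S r2[OF h] in auto)
  qed
  then obtain c where c: "S = c \<cdot>\<^sub>m 1\<^sub>m b" by blast
  have "T = c \<cdot>\<^sub>m 1\<^sub>m (a * b)"
    unfolding TS kron_one[symmetric]
    by (rule eq_block_matI[of _ a b]) (auto simp: c kron_index[of _ a _ b] block_index_less kron_one block_index_eq_iff)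
  then show ?thesis by blast
qed

section \<open>Sesquilinear spaces with a parabolic decomposition\<close>

locale parabolic_space =
  fixes cj :: "'e::{field,finite} \<Rightarrow> 'e" and eps :: 'e and k m n :: nat and M :: "'e mat"
  assumes gal: "galois_setup cj" and par: "parabolic_setup cj eps k m n M"
begin

lemma cj_add: "cj (x + y) = cj x + cj y" and cj_mult: "cj (x * y) = cj x * cj y"
  and cj_one: "cj 1 = 1" and cj_cj [simp]: "cj (cj x) = x"
  using gal unfolding galois_setup_def by blast+

sublocale cj: comm_ring_hom cj
proof
  have "cj 0 + cj 0 = cj 0 + 0" using cj_add[of 0 0] by (simp only: add_0_right)
  then show "cj 0 = 0" by (rule add_left_imp_eq)
qed (simp_all add: cj_add cj_mult cj_one)

abbreviation "conjm \<equiv> map_mat cj"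

lemma cj_eq_0_iff [simp]: "cj x = 0 \<longleftrightarrow> x = 0"
  using cj_cj[of x] by fastforce

lemma conjm_conjm [simp]: "conjm (conjm A) = A"
  by (intro eq_matI) auto

lemma M_carrier [simp]: "M \<in> carrier_mat n n"
  using par unfolding parabolic_setup_def eps_sesq_def by blast

lemma dim_M [simp]: "dim_row M = n" "dim_col M = n"
  using carrier_matD[OF M_carrier] by blast+

lemmas sq_assoc = assoc_mult_mat[of _ n n _ n _ n]
lemmas sq_carrier = mult_carrier_mat[of _ n n _ n]

lemma M_cases:
  obtains "n = k + m" "M = 0\<^sub>m n n" | "n = k + m + k" "det M \<noteq> 0"
  using par unfolding parabolic_setup_def nondeg_def by blast

lemma km_le: "k + m \<le> n" and kk_le: "k \<le> n"
  by (cases rule: M_cases; simp)+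

section \<open>Block shape of the Gram matrix and orthogonal complements\<close>

lemma M_block_zero:
  assumes ij: "i < n" "j < n" and blk: "(blk k m i = 0 \<and> blk k m j = 0) \<or> (blk k m i = 2 \<and> blk k m j = 2)
            \<or> (blk k m i = 1 \<and> blk k m j \<noteq> 1) \<or> (blk k m i \<noteq> 1 \<and> blk k m j = 1)"
  shows "M $$ (i, j) = 0"
proof -
  from par consider "M = 0\<^sub>m n n"
    | "\<forall>i<n. \<forall>j<n. (blk k m i = 0 \<and> blk k m j = 0) \<or> (blk k m i = 2 \<and> blk k m j = 2)
            \<or> (blk k m i = 1 \<and> blk k m j \<noteq> 1) \<or> (blk k m i \<noteq> 1 \<and> blk k m j = 1)
            \<longrightarrow> M $$ (i, j) = 0"
    unfolding parabolic_setup_def by argo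
  then show ?thesis
  proof cases
    case 1
    then show ?thesis using ij by simp
  next
    case 2
    then show ?thesis using ij blk by blast
  qed
qed

lemma M_X_Xperp: "i < k \<Longrightarrow> j < k + m \<Longrightarrow> M $$ (i, j) = 0"
  using km_le by (intro M_block_zero) (auto simp: blk_def)

lemma M_V0_out: "k \<le> i \<Longrightarrow> i < k + m \<Longrightarrow> j < n \<Longrightarrow> j < k \<or> k + m \<le> j \<Longrightarrow> M $$ (i, j) = 0"
  using km_le by (intro M_block_zero) (auto simp: blk_def)

lemma M_out_V0: "k \<le> j \<Longrightarrow> j < k + m \<Longrightarrow> i < n \<Longrightarrow> i < k \<or> k + m \<le> i \<Longrightarrow> M $$ (i, j) = 0"
  using km_le by (intro M_block_zero) (auto simp: blk_def)

lemma M_Y_Y: "i < n \<Longrightarrow> j < n \<Longrightarrow> k + m \<le> i \<Longrightarrow> k + m \<le> j \<Longrightarrow> M $$ (i, j) = 0"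
  by (intro M_block_zero) (auto simp: blk_def)

lemma M_V0_or_Y_Y: "k \<le> i \<Longrightarrow> i < n \<Longrightarrow> j < n \<Longrightarrow> k + m \<le> j \<Longrightarrow> M $$ (i, j) = 0"
  by (cases "i < k + m") (auto simp: M_V0_out M_Y_Y)

lemma transpose_M: "M\<^sup>T = eps \<cdot>\<^sub>m conjm M"
proof (rule eq_matI)
  fix i j assume "i < dim_row (eps \<cdot>\<^sub>m conjm M)" "j < dim_col (eps \<cdot>\<^sub>m conjm M)"
  then have ij: "i < n" "j < n" by simp_all
  have "M $$ (j, i) = eps * cj (M $$ (i, j))"
    using par ij unfolding parabolic_setup_def eps_sesq_def by blast
  then show "M\<^sup>T $$ (i, j) = (eps \<cdot>\<^sub>m conjm M) $$ (i, j)" using ij by simp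
qed simp_all

lemma eps_nonzero: "eps \<noteq> 0"
proof -
  have "eps = 1 \<or> eps = -1" using par unfolding parabolic_setup_def eps_sesq_def by blast
  then show ?thesis by auto
qed

lemma M_kernel:
  assumes "det M \<noteq> 0" "w \<in> carrier_vec n" "M *\<^sub>v w = 0\<^sub>v n"
  shows "w = 0\<^sub>v n"
  using det_0_iff_vec_prod_zero_field[OF M_carrier] assms by blast

lemma mult_M_index: "w \<in> carrier_vec n \<Longrightarrow> i < n \<Longrightarrow> (M *\<^sub>v w) $ i = (\<Sum>j<n. M $$ (i, j) * w $ j)"
  by (simp add: scalar_prod_def atLeast0LessThan)

text \<open>Geometrically: a vector orthogonal to V0 + Y lies in Y. The truncation of
  \<open>w\<close> to X + V0 has the same products with V0 + Y as \<open>w\<close> and none with X,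
  so it lies in the kernel of \<open>M\<close>.\<close>

lemma support_of_mult_M_in_X:
  assumes det: "det M \<noteq> 0" and w: "w \<in> carrier_vec n"
    and zero: "\<And>i. k \<le> i \<Longrightarrow> i < n \<Longrightarrow> (M *\<^sub>v w) $ i = 0"
    and i: "i < k + m"
  shows "w $ i = 0"
proof -
  define w' where "w' = vec n (\<lambda>i. if i < k + m then w $ i else 0)"
  have w': "w' \<in> carrier_vec n" by (simp add: w'_def)
  have "M *\<^sub>v w' = 0\<^sub>v n"
  proof (rule eq_vecI)
    fix i assume "i < dim_vec (0\<^sub>v n)"
    then have i: "i < n" by simp
    show "(M *\<^sub>v w') $ i = 0\<^sub>v n $ i"
    proof (cases "i < k")
      case True
      then have "(\<Sum>j<n. M $$ (i, j) * w' $ j) = 0"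
        by (intro sum.neutral) (auto simp: w'_def M_X_Xperp)
      then show ?thesis using i w' by (simp add: mult_M_index del: index_mult_mat_vec)
    next
      case False
      then have "(\<Sum>j<n. M $$ (i, j) * w' $ j) = (\<Sum>j<n. M $$ (i, j) * w $ j)"
        using i by (intro sum.cong) (auto simp: w'_def not_less intro: M_V0_or_Y_Y)
      also have "\<dots> = 0" using zero[of i] False i w by (simp add: mult_M_index del: index_mult_mat_vec)
      finally show ?thesis using i w' by (simp add: mult_M_index del: index_mult_mat_vec)
    qed
  qed simp
  then have "w' = 0\<^sub>v n" using M_kernel det w' by blast
  then have "w' $ i = 0" using i km_le by simp
  then show ?thesis using i km_le by (simp add: w'_def)
qed

text \<open>Geometrically: the orthogonal of X is X + V0. The Y-part of \<open>w\<close> has the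
  same products with X as \<open>w\<close> and none with V0 + Y, so it lies in the kernel of
  \<open>M\<close>.\<close>

lemma mult_M_zero_on_X:
  assumes det: "det M \<noteq> 0" and w: "w \<in> carrier_vec n"
    and zero: "\<And>i. i < k \<Longrightarrow> (M *\<^sub>v w) $ i = 0"
    and i: "k + m \<le> i" "i < n"
  shows "w $ i = 0"
proof -
  define w' where "w' = vec n (\<lambda>i. if i < k + m then 0 else w $ i)"
  have w': "w' \<in> carrier_vec n" by (simp add: w'_def)
  have "M *\<^sub>v w' = 0\<^sub>v n"
  proof (rule eq_vecI)
    fix i assume "i < dim_vec (0\<^sub>v n)"
    then have i: "i < n" by simp
    show "(M *\<^sub>v w') $ i = 0\<^sub>v n $ i"
    proof (cases "i < k")
      case False
      then have "(\<Sum>j<n. M $$ (i, j) * w' $ j) = 0"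
        using i by (intro sum.neutral) (auto simp: w'_def not_less intro: M_V0_or_Y_Y)
      then show ?thesis using i w' by (simp add: mult_M_index del: index_mult_mat_vec)
    next
      case True
      then have "(\<Sum>j<n. M $$ (i, j) * w' $ j) = (\<Sum>j<n. M $$ (i, j) * w $ j)"
        using i by (intro sum.cong) (auto simp: w'_def M_X_Xperp)
      also have "\<dots> = 0" using zero[of i] True i w by (simp add: mult_M_index del: index_mult_mat_vec)
      finally show ?thesis using i w' by (simp add: mult_M_index del: index_mult_mat_vec)
    qed
  qed simp
  then have "w' = 0\<^sub>v n" using M_kernel det w' by blast
  then have "w' $ i = 0" using i by simp
  then show ?thesis using i by (simp add: w'_def)
qed

section \<open>Calculus of adjoint pairs\<close>

text \<open>\<open>\<langle>A x, y\<rangle> = \<langle>x, B y\<rangle>\<close>. A relation rather than a function, so that the zero form, for which any two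
  matrices are adjoint, needs no separate treatment.\<close>
definition adjoint :: "'e mat \<Rightarrow> 'e mat \<Rightarrow> bool" where
  "adjoint A B \<longleftrightarrow> A \<in> carrier_mat n n \<and> B \<in> carrier_mat n n \<and> A\<^sup>T * M = M * conjm B"

lemma adjoint_carrier: "adjoint A B \<Longrightarrow> A \<in> carrier_mat n n" "adjoint A B \<Longrightarrow> B \<in> carrier_mat n n"
  by (auto simp: adjoint_def)

lemma adjoint_one: "adjoint (1\<^sub>m n) (1\<^sub>m n)"
  by (auto simp: adjoint_def cj.mat_hom_one)

lemma conjm_add: "A \<in> carrier_mat n n \<Longrightarrow> B \<in> carrier_mat n n \<Longrightarrow> conjm (A + B) = conjm A + conjm B"
  by (intro eq_matI) (auto simp: cj.hom_add)

lemma conjm_minus: "A \<in> carrier_mat n n \<Longrightarrow> B \<in> carrier_mat n n \<Longrightarrow> conjm (A - B) = conjm A - conjm B"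
  by (intro eq_matI) (auto simp: cj.hom_minus)

lemma adjoint_add: "adjoint A A' \<Longrightarrow> adjoint B B' \<Longrightarrow> adjoint (A + B) (A' + B')"
  by (auto simp: adjoint_def conjm_add transpose_add[of _ n n] add_mult_distrib_mat[of _ n n _ _ n]
      mult_add_distrib_mat[of _ n n _ n])

lemma adjoint_minus: "adjoint A A' \<Longrightarrow> adjoint B B' \<Longrightarrow> adjoint (A - B) (A' - B')"
  by (auto simp: adjoint_def conjm_minus transpose_minus[of _ n n] minus_mult_distrib_mat[of _ n n _ _ n]
      mult_minus_distrib_mat[of _ n n _ n] minus_carrier_mat)

lemma adjoint_mult:
  assumes "adjoint A A'" "adjoint B B'"
  shows "adjoint (A * B) (B' * A')"
proof -
  note c = adjoint_carrier[OF assms(1)] adjoint_carrier[OF assms(2)]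
  have "(A * B)\<^sup>T * M = B\<^sup>T * (A\<^sup>T * M)"
    using c by (simp add: transpose_mult[of _ n n] sq_assoc sq_carrier)
  also have "\<dots> = (B\<^sup>T * M) * conjm A'"
    using assms c by (simp add: adjoint_def flip: sq_assoc)
  also have "\<dots> = M * conjm (B' * A')"
    using assms c by (simp add: adjoint_def sq_assoc cj.mat_hom_mult[of _ n n _ n])
  finally show ?thesis using c by (simp add: adjoint_def sq_carrier)
qed

text \<open>Transposing the relation brings in \<open>M\<^sup>T\<close> on both sides, which is
  \<open>eps\<close> times the conjugate of \<open>M\<close>. The factor \<open>eps\<close> cancels,
  so no sign appears, and one conjugation finishes.\<close>

lemma adjoint_sym:
  assumes "adjoint A B"
  shows "adjoint B A"
proof -
  note c = adjoint_carrier[OF assms]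
  have "(A\<^sup>T * M)\<^sup>T = (M * conjm B)\<^sup>T" using assms by (simp add: adjoint_def)
  then have "M\<^sup>T * A = (conjm B)\<^sup>T * M\<^sup>T"
    using c transpose_mult[of "A\<^sup>T" n n M n] transpose_mult[of M n n "conjm B" n] by simp
  then have "eps \<cdot>\<^sub>m (conjm M * A) = eps \<cdot>\<^sub>m ((conjm B)\<^sup>T * conjm M)"
    using c by (simp add: transpose_M mult_smult_assoc_mat[of _ n n _ n] mult_smult_distrib[of _ n n _ n])
  then have eq: "conjm M * A = (conjm B)\<^sup>T * conjm M"
    by (rule smult_mat_cancel[OF eps_nonzero])
  have "M * conjm A = conjm (conjm M * A)"
    using c by (simp add: cj.mat_hom_mult[of _ n n _ n])
  also have "\<dots> = conjm ((conjm B)\<^sup>T * conjm M)" by (simp only: eq)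
  also have "\<dots> = B\<^sup>T * M"
    using c by (simp add: cj.mat_hom_mult[of _ n n _ n] map_mat_transpose)
  finally show ?thesis using c by (simp add: adjoint_def)
qed

lemma adjoint_inverse:
  assumes "adjoint A B" and A': "A' \<in> carrier_mat n n" "A * A' = 1\<^sub>m n" and B': "B' \<in> carrier_mat n n" "B * B' = 1\<^sub>m n"
  shows "adjoint A' B'"
proof -
  note c = adjoint_carrier[OF assms(1)]
  have t: "A'\<^sup>T * A\<^sup>T = 1\<^sub>m n" using A' c by (simp flip: transpose_mult[of _ n n])
  have h: "conjm B * conjm B' = 1\<^sub>m n" using B' c by (simp add: cj.mat_hom_one flip: cj.mat_hom_mult[of _ n n _ n])
  have "A'\<^sup>T * M = A'\<^sup>T * (M * (conjm B * conjm B'))" unfolding h using A' by simp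
  also have "\<dots> = A'\<^sup>T * ((M * conjm B) * conjm B')"
    using A' B' c by (simp add: sq_assoc sq_carrier)
  also have "\<dots> = A'\<^sup>T * ((A\<^sup>T * M) * conjm B')" using assms(1) by (simp add: adjoint_def)
  also have "\<dots> = (A'\<^sup>T * A\<^sup>T) * (M * conjm B')"
    using A' B' c by (simp add: sq_assoc sq_carrier)
  finally have "A'\<^sup>T * M = M * conjm B'" unfolding t using B' by simp
  then show ?thesis using A' B' by (simp add: adjoint_def)
qed

text \<open>Nondegeneracy is essential here: under the zero form any two matrices are adjoint. This
  is what later forces a case distinction in the choice of determinants.\<close>

lemma adjoint_det:
  assumes "adjoint A B" "det M \<noteq> 0"
  shows "det A = cj (det B)"
proof -
  note c = adjoint_carrier[OF assms(1)]
  have "det (A\<^sup>T * M) = det (M * conjm B)" using assms(1) by (simp add: adjoint_def)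
  then show ?thesis using c assms(2) by (simp add: det_mult[of _ n] det_transpose[of _ n])
qed

lemma adjoint_exists:
  assumes "A \<in> carrier_mat n n" "det M \<noteq> 0"
  obtains B where "adjoint A B"
proof -
  obtain M' where M': "M' \<in> carrier_mat n n" "M * M' = 1\<^sub>m n"
    using det_nonzero_obtain_inverse[OF M_carrier assms(2)] by metis
  have "adjoint A (conjm (M' * (A\<^sup>T * M)))"
    using M' assms(1) by (simp add: adjoint_def sq_carrier flip: assoc_mult_mat[of M n n M' n _ n])
  then show thesis by (rule that)
qed

section \<open>Isometries in matrix form\<close>

lemma sesq_scalar_prod:
  assumes "B \<in> carrier_mat l l" "x \<in> carrier_vec l" "y \<in> carrier_vec l"
  shows "sesq cj B x y = x \<bullet> (B *\<^sub>v map_vec cj y)"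
  using assms by (auto simp: sesq_def scalar_prod_def atLeast0LessThan sum_distrib_left mult.assoc intro!: sum.cong)

lemma isom_group_iff:
  "g \<in> isom_group cj n M \<longleftrightarrow> g \<in> carrier_mat n n \<and> det g \<noteq> 0 \<and> g\<^sup>T * M * conjm g = M"
proof -
  have eq: "sesq cj M (g *\<^sub>v x) (g *\<^sub>v y) = x \<bullet> ((g\<^sup>T * M * conjm g) *\<^sub>v map_vec cj y)"
    if g: "g \<in> carrier_mat n n" and x: "x \<in> carrier_vec n" and y: "y \<in> carrier_vec n" for x y
  proof -
    have "sesq cj M (g *\<^sub>v x) (g *\<^sub>v y) = (g *\<^sub>v x) \<bullet> (M *\<^sub>v (conjm g *\<^sub>v map_vec cj y))"
      using g x y by (simp add: sesq_scalar_prod[of _ n] cj.mult_mat_vec_hom[of _ n n])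
    also have "\<dots> = x \<bullet> (g\<^sup>T *\<^sub>v (M *\<^sub>v (conjm g *\<^sub>v map_vec cj y)))"
      using g x y transpose_vec_mult_scalar[of g n n x "M *\<^sub>v (conjm g *\<^sub>v map_vec cj y)"]
      by (metis M_carrier comm_scalar_prod map_carrier_mat map_carrier_vec mult_mat_vec_carrier transpose_carrier_mat)
    also have "\<dots> = x \<bullet> ((g\<^sup>T * M * conjm g) *\<^sub>v map_vec cj y)"
      using g y by (simp add: assoc_mult_mat_vec[of _ n n _ n] sq_assoc sq_carrier)
    finally show ?thesis .
  qed
  have "g\<^sup>T * M * conjm g = M" if g: "g \<in> carrier_mat n n"
    and inv: "\<forall>x \<in> carrier_vec n. \<forall>y \<in> carrier_vec n. sesq cj M (g *\<^sub>v x) (g *\<^sub>v y) = sesq cj M x y"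
  proof (rule eq_matI)
    fix i j assume "i < dim_row M" "j < dim_col M"
    then have ij: "i < n" "j < n" by auto
    have u: "map_vec cj (unit_vec n j) = unit_vec n j" using ij by (intro eq_vecI) (auto simp: unit_vec_def)
    have "unit_vec n i \<bullet> ((g\<^sup>T * M * conjm g) *\<^sub>v unit_vec n j) = unit_vec n i \<bullet> (M *\<^sub>v unit_vec n j)"
      using eq[OF g, of "unit_vec n i" "unit_vec n j"] inv ij u by (simp add: sesq_scalar_prod[of _ n])
    moreover have "(g\<^sup>T * M * conjm g) \<in> carrier_mat n n" using g by (intro mult_carrier_mat[of _ n n]) auto
    ultimately show "(g\<^sup>T * M * conjm g) $$ (i, j) = M $$ (i, j)"
      using ij g mult_mat_vec_carrier[OF M_carrier unit_vec_carrier[of n j]] by (simp del: index_mult_mat(1) assoc_mult_mat)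
  qed (use g in auto)
  moreover have "sesq cj M (g *\<^sub>v x) (g *\<^sub>v y) = sesq cj M x y"
    if "g \<in> carrier_mat n n" "g\<^sup>T * M * conjm g = M" "x \<in> carrier_vec n" "y \<in> carrier_vec n" for x y
    using eq[OF that(1,3,4)] that(3,4) unfolding that(2) by (simp add: sesq_scalar_prod[of _ n])
  ultimately show ?thesis unfolding isom_group_def by blast
qed

abbreviation G where "G \<equiv> isom_group cj n M"

lemma G_carrier: "g \<in> G \<Longrightarrow> g \<in> carrier_mat n n" and G_det: "g \<in> G \<Longrightarrow> det g \<noteq> 0"
  by (auto simp: isom_group_def)

lemma finite_G: "finite G"
  by (rule finite_subset[OF _ finite_carrier_mat[of n n]]) (auto simp: isom_group_def)

lemma one_in_G: "1\<^sub>m n \<in> G"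
  by (simp add: isom_group_iff cj.mat_hom_one)

lemma G_mult: "g \<in> G \<Longrightarrow> h \<in> G \<Longrightarrow> g * h \<in> G"
  by (auto simp: isom_group_def det_mult[of _ n] assoc_mult_mat_vec[of _ n n _ n] sq_carrier)

text \<open>Together with \<open>adjoint_imp_G\<close>: the isometries are the matrices with an
  inverse that is also an adjoint. The perturbed unipotent elements are recognized as isometries in
  this way.\<close>

lemma G_adjoint:
  assumes "g \<in> G" "g' \<in> carrier_mat n n" "g * g' = 1\<^sub>m n"
  shows "adjoint g g'"
proof -
  have g: "g \<in> carrier_mat n n" "g\<^sup>T * M * conjm g = M" using assms(1) by (auto simp: isom_group_iff)
  have "M * conjm g' = g\<^sup>T * M * (conjm g * conjm g')"
    using g assms(2) assoc_mult_mat[of "g\<^sup>T * M" n n "conjm g" n "conjm g'" n] by (simp add: sq_carrier del: assoc_mult_mat)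
  also have "conjm g * conjm g' = 1\<^sub>m n"
    using g assms by (simp add: cj.mat_hom_one flip: cj.mat_hom_mult[of _ n n _ n])
  finally show ?thesis using g assms(2) by (simp add: adjoint_def)
qed

lemma adjoint_imp_G:
  assumes "adjoint g g'" "g * g' = 1\<^sub>m n"
  shows "g \<in> G"
proof -
  note c = adjoint_carrier[OF assms(1)]
  have "g' * g = 1\<^sub>m n" using mat_mult_left_right_inverse[OF c assms(2)] .
  then have "conjm g' * conjm g = 1\<^sub>m n" using c by (simp add: cj.mat_hom_one flip: cj.mat_hom_mult[of _ n n _ n])
  then have "g\<^sup>T * M * conjm g = M" using assms(1) c by (simp add: adjoint_def sq_assoc sq_carrier)
  then show ?thesis using c mult_one_imp_det_nonzero[OF c assms(2)] by (simp add: isom_group_iff)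
qed

lemma G_inverse:
  assumes "g \<in> G" "g' \<in> carrier_mat n n" "g * g' = 1\<^sub>m n"
  shows "g' \<in> G"
proof (rule finite_mat_monoid_inverse[OF finite_G _ one_in_G G_mult assms])
  show "G \<subseteq> {A \<in> carrier_mat n n. det A \<noteq> 0}" by (auto simp: isom_group_def)
qed

lemma G_obtain_inverse:
  assumes "g \<in> G"
  obtains g' where "g' \<in> G" "g * g' = 1\<^sub>m n" "g' * g = 1\<^sub>m n"
  using det_nonzero_obtain_inverse[OF G_carrier[OF assms] G_det[OF assms]] G_inverse[OF assms] by metis

subsection \<open>The unipotent radical\<close>

text \<open>The stabilizer is taken in all of GL(V) because it will be tested on \<open>b\<close>
  and on \<open>1 + g'\<close>, which need not be isometries.\<close>

definition stab_X :: "'e mat set" where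
  "stab_X = {A \<in> carrier_mat n n. det A \<noteq> 0 \<and> (\<forall>i<n. \<forall>j<k. k \<le> i \<longrightarrow> A $$ (i, j) = 0)}"

lemma stab_X_inverse:
  assumes "A \<in> stab_X" "B \<in> carrier_mat n n" "A * B = 1\<^sub>m n"
  shows "B \<in> stab_X"
proof (rule finite_mat_monoid_inverse[OF _ _ _ _ assms])
  show "finite stab_X" by (rule finite_subset[OF _ finite_carrier_mat[of n n]]) (auto simp: stab_X_def)
  show "stab_X \<subseteq> {A \<in> carrier_mat n n. det A \<noteq> 0}" by (auto simp: stab_X_def)
  show "1\<^sub>m n \<in> stab_X" using kk_le by (auto simp: stab_X_def)
  fix A B assume A: "A \<in> stab_X" and B: "B \<in> stab_X"
  have c: "A \<in> carrier_mat n n" "B \<in> carrier_mat n n" "det A \<noteq> 0" "det B \<noteq> 0"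
    using A B by (auto simp: stab_X_def)
  have "(A * B) $$ (i, j) = 0" if "i < n" "j < k" "k \<le> i" for i j
    by (rule mult_mat_zero_terms[OF c(1,2)])
      (use A B that kk_le in \<open>auto simp: stab_X_def not_less[symmetric]\<close>)
  then show "A * B \<in> stab_X" using c by (auto simp: stab_X_def det_mult[of _ n] sq_carrier simp del: index_mult_mat(1))
qed

text \<open>An isometry preserving X also preserves its orthogonal X + V0: for x in X, the product
  of x with \<open>g\<close> y equals that of \<open>g'\<close> x with y, and \<open>g'\<close> x is
  again in X.\<close>

lemma stab_X_imp_parabolic:
  assumes g: "g \<in> G" "g \<in> stab_X"
  shows "g \<in> parabolic cj k m n M"
proof -
  obtain g' where g': "g' \<in> G" "g * g' = 1\<^sub>m n" "g' * g = 1\<^sub>m n" using G_obtain_inverse[OF g(1)] .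
  note c = G_carrier[OF g(1)] G_carrier[OF g'(1)]
  have g'X: "g' \<in> stab_X" using stab_X_inverse[OF g(2) c(2) g'(2)] .
  have Y: "g $$ (i, j) = 0" if ij: "k + m \<le> i" "i < n" "k \<le> j" "j < k + m" for i j
  proof (cases rule: M_cases)
    case 1
    then show ?thesis using ij by simp
  next
    case 2
    have jn: "j < n" using ij by simp
    have adj: "g'\<^sup>T * M = M * conjm g" using G_adjoint[OF g'(1) c(1) g'(3)] by (simp add: adjoint_def)
    have "col (conjm g) j $ i = 0"
    proof (rule mult_M_zero_on_X[OF 2(2) _ _ ij(1,2)])
      show "col (conjm g) j \<in> carrier_vec n" using c jn by simp
      fix r assume r: "r < k"
      then have rn: "r < n" using kk_le by simp
      have "(M *\<^sub>v col (conjm g) j) $ r = (M * conjm g) $$ (r, j)" using c rn jn by simp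
      also have "\<dots> = (g'\<^sup>T * M) $$ (r, j)" by (simp only: adj)
      also have "\<dots> = 0"
      proof (rule mult_mat_zero_terms[OF _ M_carrier rn jn])
        fix l assume l: "l < n"
        show "g'\<^sup>T $$ (r, l) = 0 \<or> M $$ (l, j) = 0"
        proof (cases "l < k")
          case True
          then show ?thesis using M_X_Xperp ij by simp
        next
          case False
          then show ?thesis using g'X l r rn c by (simp add: stab_X_def)
        qed
      qed (use c in simp)
      finally show "(M *\<^sub>v col (conjm g) j) $ r = 0" .
    qed
    then show ?thesis using c ij jn by simp
  qed
  have X: "g $$ (i, j) = 0" if "i < n" "j < k" "k \<le> i" for i j using g(2) that by (simp add: stab_X_def)
  show ?thesis unfolding parabolic_def
  proof (intro CollectI conjI allI impI g(1))
    fix i j assume "i < n" "j < n" "blk k m j < blk k m i"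
    then show "g $$ (i, j) = 0" using X[of i j] Y[of i j] by (auto simp: blk_def split: if_splits)
  qed
qed

text \<open>In terms of the flag: X is killed and X + V0 is sent into X. For the zero form this is
  Hom(V0, X).\<close>

definition nilp :: "'e mat \<Rightarrow> bool" where
  "nilp N \<longleftrightarrow> N \<in> carrier_mat n n \<and> (\<forall>i<n. \<forall>j<n. j < k \<or> (j < k + m \<and> k \<le> i) \<longrightarrow> N $$ (i, j) = 0)"

text \<open>Triviality on \<open>V / (X + V0)\<close> is not imposed: it follows from
  being an isometry.\<close>
definition unip :: "'e mat set" where
  "unip = {u \<in> G. nilp (u - 1\<^sub>m n)}"

lemma nilp_carrier: "nilp N \<Longrightarrow> N \<in> carrier_mat n n"
  by (simp add: nilp_def)

lemma nilpD: "nilp N \<Longrightarrow> i < n \<Longrightarrow> j < n \<Longrightarrow> j < k \<or> (j < k + m \<and> k \<le> i) \<Longrightarrow> N $$ (i, j) = 0"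
  unfolding nilp_def by blast

lemma unip_G: "u \<in> unip \<Longrightarrow> u \<in> G" and unip_carrier: "u \<in> unip \<Longrightarrow> u \<in> carrier_mat n n"
  by (auto simp: unip_def G_carrier)

lemma one_plus_minus: "A \<in> carrier_mat n n \<Longrightarrow> 1\<^sub>m n + (A - 1\<^sub>m n) = (A :: 'e mat)"
  by (intro eq_matI) auto

lemma minus_one_plus: "A \<in> carrier_mat n n \<Longrightarrow> 1\<^sub>m n + A - 1\<^sub>m n = (A :: 'e mat)"
  by (intro eq_matI) auto

lemma nilp_add: "nilp A \<Longrightarrow> nilp B \<Longrightarrow> nilp (A + B)"
  by (auto simp: nilp_def)

lemma nilp_mult:
  assumes A: "nilp A" and B: "nilp B"
  shows "nilp (A * B)"
proof -
  note c = nilp_carrier[OF A] nilp_carrier[OF B]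
  have "(A * B) $$ (i, j) = 0" if ij: "i < n" "j < n" "j < k \<or> (j < k + m \<and> k \<le> i)" for i j
  proof (rule mult_mat_zero_terms[OF c ij(1,2)])
    fix l assume "l < n"
    then show "A $$ (i, l) = 0 \<or> B $$ (l, j) = 0"
      using nilpD[OF A, of i l] nilpD[OF B, of l j] ij by (cases "l < k") auto
  qed
  then show ?thesis using c by (simp add: nilp_def sq_carrier del: index_mult_mat(1))
qed

lemma unip_mult:
  assumes u: "u \<in> unip" and v: "v \<in> unip"
  shows "u * v \<in> unip"
proof -
  define N N' where "N = u - 1\<^sub>m n" and "N' = v - 1\<^sub>m n"
  have N: "nilp N" "nilp N'" using u v by (auto simp: unip_def N_def N'_def)
  note c = nilp_carrier[OF N(1)] nilp_carrier[OF N(2)]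
  have uv: "u = 1\<^sub>m n + N" "v = 1\<^sub>m n + N'"
    using unip_carrier[OF u] unip_carrier[OF v] by (auto simp: N_def N'_def one_plus_minus)
  have "u * v = 1\<^sub>m n + (N + (N' + N * N'))"
    unfolding uv using c
    by (simp add: add_mult_distrib_mat[of _ n n _ _ n] mult_add_distrib_mat[of _ n n _ n] sq_carrier assoc_add_mat[of _ n n])
  then have "u * v - 1\<^sub>m n = N + (N' + N * N')" using c by (simp add: minus_one_plus sq_carrier)
  then show ?thesis using G_mult[OF unip_G[OF u] unip_G[OF v]] N by (simp add: unip_def nilp_add nilp_mult)
qed

lemma finite_unip: "finite unip"
  by (rule finite_subset[OF _ finite_G]) (auto simp: unip_def)

lemma unip_index:
  assumes u: "u \<in> unip" and ij: "i < n" "j < n" "j < k \<or> (j < k + m \<and> k \<le> i)"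
  shows "u $$ (i, j) = (if i = j then 1 else 0)"
proof -
  have "nilp (u - 1\<^sub>m n)" using u by (simp add: unip_def)
  then have "(u - 1\<^sub>m n) $$ (i, j) = 0" using ij by (rule nilpD)
  then show ?thesis using ij unip_carrier[OF u] by (simp split: if_splits)
qed

lemma unip_levi:
  assumes u: "u \<in> unip"
  shows "u \<in> parabolic cj k m n M" "levi_X k u = 1\<^sub>m k" "levi_0 k m u = 1\<^sub>m m"
proof -
  have "u $$ (i, j) = 0" if "i < n" "j < n" "blk k m j < blk k m i" for i j
    using unip_index[OF u that(1,2)] that by (auto simp: blk_def split: if_splits)
  then show "u \<in> parabolic cj k m n M" using unip_G[OF u] by (simp add: parabolic_def)
  show "levi_X k u = 1\<^sub>m k"
    using unip_index[OF u] kk_le by (intro eq_matI) (auto simp: levi_X_def)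
  show "levi_0 k m u = 1\<^sub>m m"
    using unip_index[OF u] km_le by (intro eq_matI) (auto simp: levi_0_def)
qed

text \<open>\<open>u\<close> is unitriangular. The zeros in the rows of Y come from the isometry
  condition: \<open>u\<close> fixes X pointwise, so \<open>(u - 1) y\<close> is orthogonal to X and
  lies in X + V0. The result keeps cosets of U inside or outside \<open>isom_group0\<close> as a
  whole.\<close>

lemma unip_det:
  assumes u: "u \<in> unip"
  shows "det u = 1"
proof -
  note c = unip_carrier[OF u]
  have Y: "(u - 1\<^sub>m n) $$ (i, j) = 0" if ij: "k + m \<le> i" "i < n" "j < n" for i j
  proof (cases rule: M_cases)
    case 1
    then show ?thesis using ij by simp
  next
    case 2
    define N where "N = u - 1\<^sub>m n"
    have N: "N \<in> carrier_mat n n" using c by (simp add: N_def minus_carrier_mat)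
    have eq: "u\<^sup>T * M * conjm u = M" using unip_G[OF u] by (simp add: isom_group_iff)
    have uN: "conjm u = 1\<^sub>m n + conjm N"
      using c by (auto simp: N_def cj.hom_minus intro!: eq_matI)
    have "col (conjm N) j $ i = 0"
    proof (rule mult_M_zero_on_X[OF 2(2) _ _ ij(1,2)])
      show "col (conjm N) j \<in> carrier_vec n" using N ij by simp
      fix r assume r: "r < k"
      then have rn: "r < n" using kk_le by simp
      have uM: "(u\<^sup>T * M) $$ (r, l) = M $$ (r, l)" if l: "l < n" for l
      proof -
        have "(u\<^sup>T * M) $$ (r, l) = (\<Sum>s<n. u $$ (s, r) * M $$ (s, l))"
          using c rn l M_carrier by (simp add: mult_mat_index_lessThan[of _ n n _ n] del: index_mult_mat(1))
        also have "\<dots> = (\<Sum>s<n. if s = r then M $$ (s, l) else 0)"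
          using unip_index[OF u _ rn] r by (intro sum.cong) auto
        finally show ?thesis using rn by simp
      qed
      have "M $$ (r, j) = (u\<^sup>T * M * conjm u) $$ (r, j)" by (simp only: eq)
      also have "\<dots> = (\<Sum>l<n. (u\<^sup>T * M) $$ (r, l) * conjm u $$ (l, j))"
        using c rn ij by (simp add: mult_mat_index_lessThan[of _ n n] sq_carrier del: index_mult_mat(1) assoc_mult_mat)
      also have "\<dots> = (\<Sum>l<n. M $$ (r, l) * conjm u $$ (l, j))" by (rule sum.cong) (simp_all only: uM lessThan_iff)
      also have "\<dots> = (M * conjm u) $$ (r, j)"
        using c rn ij by (simp add: mult_mat_index_lessThan[of _ n n _ n] del: index_mult_mat(1))
      also have "\<dots> = M $$ (r, j) + (M * conjm N) $$ (r, j)"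
        unfolding uN using N rn ij by (simp add: mult_add_distrib_mat[of _ n n _ n] del: index_mult_mat(1))
      finally have "(M * conjm N) $$ (r, j) = 0" by simp
      then show "(M *\<^sub>v col (conjm N) j) $ r = 0" using N rn ij by simp
    qed
    then show ?thesis using N ij by (simp add: N_def)
  qed
  have low: "u $$ (i, j) = (if i = j then 1 else 0)" if ij: "i < n" "j \<le> i" for i j
  proof (cases "j < k \<or> (j < k + m \<and> k \<le> i)")
    case True
    then show ?thesis using unip_index[OF u, of i j] ij by simp
  next
    case False
    then have "(u - 1\<^sub>m n) $$ (i, j) = 0" using Y[of i j] ij by auto
    then show ?thesis using c ij by (simp split: if_splits)
  qed
  have "upper_triangular u" using c low by (auto simp: upper_triangular_def)
  moreover have "diag_mat u = map (\<lambda>i. 1) [0..<n]" using c low by (auto simp: diag_mat_def)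
  ultimately show ?thesis using det_upper_triangular[OF _ c] by (simp add: map_replicate_const)
qed

section \<open>Rescaling the determinant along a coset of the unipotent radical\<close>

lemma adjoint_elementary:
  assumes p: "p < k" and q: "q < n"
    and c_def: "c = mat n n (\<lambda>(i, j). if i = p \<and> j = q then t else 0)"
  shows "\<exists>d. adjoint c d \<and> (\<forall>i<n. \<forall>j<k + m. d $$ (i, j) = 0) \<and>
    (\<forall>A B. adjoint A B \<longrightarrow> A * c = 0\<^sub>m n n \<longrightarrow> d * B = 0\<^sub>m n n) \<and> (M = 0\<^sub>m n n \<longrightarrow> d = 0\<^sub>m n n)"
proof -
  have c: "c \<in> carrier_mat n n" by (simp add: c_def)
  show ?thesis
  proof (cases rule: M_cases)
    case 1
    \<comment> \<open>Every matrix is adjoint to \<open>c\<close> here, but the annihilation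
      property leaves only 0: the pair \<open>A = 0\<close>, \<open>B = 1\<close> is adjoint as
      well.\<close>
    have "adjoint c (0\<^sub>m n n)" unfolding adjoint_def using c by (simp add: 1(2))
    moreover have "0\<^sub>m n n * B = 0\<^sub>m n n" if "adjoint A B" for A B
      using adjoint_carrier[OF that] by (simp add: left_mult_zero_mat)
    ultimately show ?thesis using km_le by (intro exI[of _ "0\<^sub>m n n"]) auto
  next
    case 2
    obtain d where d: "adjoint c d" using adjoint_exists[OF c 2(2)] .
    note dc = adjoint_carrier[OF d]
    \<comment> \<open>\<open>c\<close> has image in X, which is orthogonal to X + V0; hence
      \<open>d\<close> kills X + V0.\<close>
    have "d $$ (i, j) = 0" if ij: "i < n" "j < k + m" for i j
    proof -
      have jn: "j < n" using ij km_le by simp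
      have "M *\<^sub>v col (conjm d) j = 0\<^sub>v n"
      proof (rule eq_vecI)
        fix r assume "r < dim_vec (0\<^sub>v n)"
        then have r: "r < n" by simp
        have "(M *\<^sub>v col (conjm d) j) $ r = (M * conjm d) $$ (r, j)" using dc r jn by simp
        also have "\<dots> = (c\<^sup>T * M) $$ (r, j)" using d by (simp add: adjoint_def)
        also have "\<dots> = 0"
          by (rule mult_mat_zero_terms[OF _ M_carrier r jn])
            (use c r ij p M_X_Xperp[of p j] in \<open>auto simp: c_def\<close>)
        finally show "(M *\<^sub>v col (conjm d) j) $ r = 0\<^sub>v n $ r" using r by simp
      qed simp
      moreover have "col (conjm d) j \<in> carrier_vec n" using dc jn by simp
      ultimately have "col (conjm d) j = 0\<^sub>v n" using M_kernel[OF 2(2)] by blast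
      then have "col (conjm d) j $ i = 0" using ij by simp
      then show ?thesis using dc ij jn by simp
    qed
    \<comment> \<open>This is the adjoint of \<open>A * c = 0\<close>, made an equation by
      cancelling the invertible \<open>M\<close>.\<close>
    moreover have "d * B = 0\<^sub>m n n" if AB: "adjoint A B" "A * c = 0\<^sub>m n n" for A B
    proof -
      note cB = adjoint_carrier[OF AB(1)]
      have "adjoint (0\<^sub>m n n) (d * B)" using adjoint_mult[OF AB(1) d] AB(2) by simp
      then have "(0\<^sub>m n n)\<^sup>T * M = M * conjm (d * B)" unfolding adjoint_def by blast
      moreover have "(0\<^sub>m n n)\<^sup>T * M = M * 0\<^sub>m n n" by simp
      ultimately have "M * conjm (d * B) = M * 0\<^sub>m n n" by (simp only:)
      moreover have "conjm (d * B) \<in> carrier_mat n n" using dc cB by (simp add: sq_carrier)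
      ultimately have z: "conjm (d * B) = 0\<^sub>m n n"
        using mult_left_cancel_mat[OF M_carrier 2(2), of "conjm (d * B)" n "0\<^sub>m n n"] zero_carrier_mat by blast
      have "d * B = conjm (conjm (d * B))" by simp
      also have "\<dots> = 0\<^sub>m n n" unfolding z by (intro eq_matI) auto
      finally show ?thesis .
    qed
    moreover have "M \<noteq> 0\<^sub>m n n \<or> d = 0\<^sub>m n n"
    proof (cases "n = 0")
      case True
      then show ?thesis using dc by (intro disjI2 eq_matI) auto
    next
      case False
      then have "det (0\<^sub>m n n :: 'e mat) = 0" by (simp add: det_zero)
      then show ?thesis using 2 by auto
    qed
    ultimately show ?thesis using d by (intro exI[of _ d]) blast
  qed
qed

text \<open>The permutation sends \<open>1 + N\<close> to \<open>1 + P N\<close>, where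
  \<open>P\<close> is affine in \<open>N\<close> with coefficient \<open>s\<close> on the left and
  \<open>tt\<close> on the right. Both are invertible, so the map is injective, and finiteness of
  \<open>unip\<close> makes it onto.\<close>

lemma unip_rescaling:
  assumes g: "g \<in> G" "det (1\<^sub>m n + g) \<noteq> 0" "g \<notin> parabolic cj k m n M" and x: "x \<noteq> 0"
  shows "\<exists>T. bij_betw T unip unip \<and>
    (\<forall>u\<in>unip. det (1\<^sub>m n + g * T u) = x * cj x * det (1\<^sub>m n + g * u))"
proof -
  obtain g' where g': "g' \<in> G" "g * g' = 1\<^sub>m n" "g' * g = 1\<^sub>m n" using G_obtain_inverse[OF g(1)] .
  note cg = G_carrier[OF g(1)] G_carrier[OF g'(1)]
  have c1g: "1\<^sub>m n + g \<in> carrier_mat n n" "1\<^sub>m n + g' \<in> carrier_mat n n" using cg by auto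
  obtain h where h: "h \<in> carrier_mat n n" "(1\<^sub>m n + g) * h = 1\<^sub>m n" "h * (1\<^sub>m n + g) = 1\<^sub>m n" "det h \<noteq> 0"
    using det_nonzero_obtain_inverse[OF c1g(1) g(2)] .
  define b where "b = g * h"
  have b: "b \<in> carrier_mat n n" using cg h by (simp add: b_def sq_carrier)
  have hb: "h + b = 1\<^sub>m n"
    using h(2) cg h(1) by (simp add: b_def add_mult_distrib_mat[of _ n n _ _ n])
  have h_eq: "h = 1\<^sub>m n - b" using b h(1) unfolding hb[symmetric] by (intro eq_matI) auto
  have det_b: "det b \<noteq> 0" using cg h G_det[OF g(1)] by (simp add: b_def det_mult[of _ n])
  have gb: "(1\<^sub>m n + g) * b = g"
  proof -
    have "(1\<^sub>m n + g) * g = g * (1\<^sub>m n + g)"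
      using cg by (simp add: add_mult_distrib_mat[of _ n n _ _ n] mult_add_distrib_mat[of _ n n _ n])
    then have "(1\<^sub>m n + g) * b = g * ((1\<^sub>m n + g) * h)"
      using cg c1g h(1) unfolding b_def by (simp flip: sq_assoc)
    then show ?thesis using cg by (simp add: h(2))
  qed
  have b_inv: "(1\<^sub>m n + g') * b = 1\<^sub>m n"
  proof -
    have "(1\<^sub>m n + g') * b = b + g' * g * h"
      using cg h(1) b by (simp add: add_mult_distrib_mat[of _ n n _ _ n] b_def sq_assoc)
    also have "\<dots> = 1\<^sub>m n" unfolding g'(3) using hb b h(1) by (simp add: comm_add_mat[of _ n n])
    finally show ?thesis .
  qed
  have adj_g: "adjoint (1\<^sub>m n + g) (1\<^sub>m n + g')"
    by (rule adjoint_add[OF adjoint_one G_adjoint[OF g(1) cg(2) g'(2)]])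
  \<comment> \<open>The adjoint pair \<open>1 + g\<close>, \<open>1 + g'\<close> has inverses
    \<open>h = 1 - b\<close> and \<open>b\<close>, which are therefore adjoint too.\<close>
  have adj_b: "adjoint b (1\<^sub>m n - b)"
    unfolding h_eq[symmetric] by (rule adjoint_sym, rule adjoint_inverse[OF adj_g h(1,2) b b_inv])
  obtain p q where pq: "p < k" "k \<le> q" "q < n" "b $$ (q, p) \<noteq> 0"
  proof (rule ccontr)
    assume "\<not> thesis"
    \<comment> \<open>If \<open>b\<close> preserved X, so would its inverse \<open>1 + g'\<close>,
      hence also \<open>g'\<close> and \<open>g\<close>, and \<open>g\<close> would lie in
      P.\<close>
    then have "b \<in> stab_X" using that b det_b by (auto simp: stab_X_def)
    then have "1\<^sub>m n + g' \<in> stab_X"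
      using stab_X_inverse[of b "1\<^sub>m n + g'"] c1g(2) mat_mult_left_right_inverse[OF c1g(2) b b_inv] by simp
    then have "(1\<^sub>m n + g') $$ (i, j) = 0" if "i < n" "j < k" "k \<le> i" for i j
      using that by (simp add: stab_X_def)
    then have "g' $$ (i, j) = 0" if "i < n" "j < k" "k \<le> i" for i j
      using that cg by fastforce
    then have "g' \<in> stab_X" using cg G_det[OF g'(1)] by (simp add: stab_X_def)
    then have "g \<in> stab_X" using stab_X_inverse g'(3) cg by blast
    then show False using stab_X_imp_parabolic g by blast
  qed
  have pn: "p < n" using pq by simp
  \<comment> \<open>The outer factors contribute \<open>y1\<close> and, for a nondegenerate form,
    its conjugate. For the zero form the right factor is 1, so \<open>y1\<close> has to be the whole
    norm.\<close>
  define y1 where "y1 = (if M = 0\<^sub>m n n then x * cj x else x)"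
  have y1: "y1 \<noteq> 0" using x by (simp add: y1_def)
  \<comment> \<open>The solution of \<open>1 + t * b $$ (q, p) = y1\<close>, the left side being
    \<open>det (1 + b c)\<close>.\<close>
  define t where "t = (y1 - 1) / b $$ (q, p)"
  define c where "c = mat n n (\<lambda>(i, j). if i = p \<and> j = q then t else 0)"
  have c: "c \<in> carrier_mat n n" by (simp add: c_def)
  have det_bc: "det (1\<^sub>m n + b * c) = y1"
    unfolding c_def using det_one_plus_column[OF b pn pq(3), of t] pq(4) by (simp add: t_def)
  have mult_c: "A * c = 0\<^sub>m n n" if A: "A \<in> carrier_mat n n" and z: "\<And>i. i < n \<Longrightarrow> A $$ (i, p) = 0" for A
  proof (rule eq_matI)
    fix i j assume "i < dim_row (0\<^sub>m n n :: 'e mat)" "j < dim_col (0\<^sub>m n n :: 'e mat)"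
    then have ij: "i < n" "j < n" by auto
    have "(A * c) $$ (i, j) = 0"
      by (rule mult_mat_zero_terms[OF A c ij]) (use z ij in \<open>auto simp: c_def\<close>)
    then show "(A * c) $$ (i, j) = 0\<^sub>m n n $$ (i, j)" using ij by simp
  qed (use A c in auto)
  have nilp_c: "nilp c" using pq by (auto simp: nilp_def c_def)
  \<comment> \<open>The image of \<open>c\<close> lies in X, which \<open>N\<close> kills.\<close>
  have N_c: "N * c = 0\<^sub>m n n" if "nilp N" for N
    by (rule mult_c[OF nilp_carrier[OF that]]) (use nilpD[OF that] pq pn in auto)
  obtain d where d: "adjoint c d" and d_zero: "\<And>i j. i < n \<Longrightarrow> j < k + m \<Longrightarrow> d $$ (i, j) = 0"
    and d_ann: "\<And>A B. adjoint A B \<Longrightarrow> A * c = 0\<^sub>m n n \<Longrightarrow> d * B = 0\<^sub>m n n"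
    and d_M: "M = 0\<^sub>m n n \<longrightarrow> d = 0\<^sub>m n n"
    using adjoint_elementary[OF pq(1,3) c_def] by blast
  have cd: "d \<in> carrier_mat n n" using adjoint_carrier[OF d] by simp
  have bc: "b * c \<in> carrier_mat n n" "c * b \<in> carrier_mat n n" "b * d \<in> carrier_mat n n"
    using b c cd by (auto simp: sq_carrier)
  define s where "s = 1\<^sub>m n + c * b"
  define tt where "tt = 1\<^sub>m n - b * d"
  have s: "s \<in> carrier_mat n n" and tt: "tt \<in> carrier_mat n n" using bc by (auto simp: s_def tt_def minus_carrier_mat)
  have det_s: "det s = y1"
  proof -
    \<comment> \<open>Sylvester's identity \<open>det (1 + c b) = det (1 + b c)\<close>, here by
      cancelling the invertible \<open>b\<close>.\<close>
    have "b * s = (1\<^sub>m n + b * c) * b"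
      unfolding s_def using b c bc by (simp add: add_mult_distrib_mat[of _ n n _ _ n] mult_add_distrib_mat[of _ n n _ n] sq_assoc)
    then have "det b * det s = det (1\<^sub>m n + b * c) * det b"
      using det_mult[OF b s] det_mult[OF add_carrier_mat[OF bc(1)] b, of "1\<^sub>m n"] by metis
    then show ?thesis using det_bc det_b by simp
  qed
  have det_1c: "det (1\<^sub>m n - c) = 1"
  proof -
    have "upper_triangular (1\<^sub>m n - c)" using pq c by (auto simp: upper_triangular_def c_def)
    moreover have "diag_mat (1\<^sub>m n - c) = map (\<lambda>i. 1) [0..<n]" using pq c by (auto simp: diag_mat_def c_def)
    moreover have "1\<^sub>m n - c \<in> carrier_mat n n" using c by (simp add: minus_carrier_mat)
    ultimately show ?thesis using det_upper_triangular[of "1\<^sub>m n - c" n] by (simp add: map_replicate_const)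
  qed
  have adj_tt: "adjoint tt (1\<^sub>m n - c * (1\<^sub>m n - b))"
    unfolding tt_def by (rule adjoint_minus[OF adjoint_one adjoint_mult[OF adj_b adjoint_sym[OF d]]])
  have det_tt: "y1 * det tt = x * cj x"
  proof (cases "M = 0\<^sub>m n n")
    case True
    then have "tt = 1\<^sub>m n" using d_M b by (intro eq_matI) (auto simp: tt_def)
    then show ?thesis using True by (simp add: y1_def)
  next
    case False
    \<comment> \<open>As \<open>c * c = 0\<close>, the product \<open>(1 - c) * s\<close> is
      \<open>1 - c (1 - b)\<close>, the adjoint of \<open>tt\<close>. Since \<open>1 - c\<close> is
      unitriangular, \<open>det tt\<close> is the conjugate of \<open>det s\<close>.\<close>
    then have det_M: "det M \<noteq> 0" by (cases rule: M_cases) auto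
    have "(1\<^sub>m n - c) * s = s - c * s" using c s by (simp add: minus_mult_distrib_mat[of _ n n _ _ n])
    also have "c * s = c + (c * c) * b"
      unfolding s_def using b c bc by (simp add: mult_add_distrib_mat[of _ n n _ n] sq_assoc)
    also have "\<dots> = c" unfolding N_c[OF nilp_c] using b c by (simp add: left_mult_zero_mat)
    also have "s - c = 1\<^sub>m n - (c - c * b)" unfolding s_def using c bc
      by (intro eq_matI) (simp_all add: carrier_matD[OF c] carrier_matD[OF b] del: index_mult_mat(1))
    also have "c - c * b = c * (1\<^sub>m n - b)" using b c by (simp add: mult_minus_distrib_mat[of _ n n _ n])
    finally have "det (1\<^sub>m n - c * (1\<^sub>m n - b)) = det (1\<^sub>m n - c) * det s"
      using det_mult[of "1\<^sub>m n - c" n s] c s by (simp add: minus_carrier_mat)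
    then have "det tt = cj y1" using adjoint_det[OF adj_tt det_M] det_1c det_s by simp
    then show ?thesis using False by (simp add: y1_def)
  qed
  have det_tt0: "det tt \<noteq> 0" using det_tt x by auto
  define K where "K N = s * N + c" for N
  define P where "P N = K N * tt - d" for N
  have K: "K N \<in> carrier_mat n n" and P: "P N \<in> carrier_mat n n" if "N \<in> carrier_mat n n" for N
    using that s c tt cd by (auto simp: K_def P_def sq_carrier minus_carrier_mat)
  have nilp_P: "nilp (P N)" if N: "nilp N" for N
  proof -
    note cN = nilp_carrier[OF N]
    \<comment> \<open>\<open>N\<close> and \<open>c\<close> have the required shape,
      \<open>c (b N)\<close> kills X and has image in X, and every term ending in \<open>d\<close>
      kills X + V0.\<close>
    have K_eq: "K N = N + (c * (b * N) + c)"
      unfolding K_def s_def using b c cN bc by (simp add: add_mult_distrib_mat[of _ n n _ _ n] sq_assoc sq_carrier assoc_add_mat[of _ n n])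
    have "P N = K N - (K N * b) * d - d"
      unfolding P_def tt_def using K[OF cN] b cd bc by (simp add: mult_minus_distrib_mat[of _ n n _ n] sq_assoc)
    moreover have "((K N * b) * d) $$ (i, j) = 0" if "i < n" "j < k + m" for i j
      by (rule mult_mat_zero_col[of _ n]) (use K[OF cN] b cd that d_zero km_le in \<open>auto simp: sq_carrier\<close>)
    moreover have "(c * (b * N)) $$ (i, j) = 0" if ij: "i < n" "j < n" "j < k \<or> (j < k + m \<and> k \<le> i)" for i j
    proof (cases "j < k")
      case True
      have "(b * N) $$ (l, j) = 0" if "l < n" for l
        by (rule mult_mat_zero_col[OF b cN that ij(2)]) (use nilpD[OF N] True ij in auto)
      then show ?thesis using mult_mat_zero_col[OF c _ ij(1,2), of "b * N"] b cN by (simp add: sq_carrier del: index_mult_mat(1))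
    next
      case False
      then show ?thesis
        by (intro mult_mat_zero_row[OF c _ ij(1,2)]) (use b cN ij pq in \<open>auto simp: sq_carrier c_def\<close>)
    qed
    ultimately show ?thesis
      using nilpD[OF N] nilpD[OF nilp_c] d_zero K[OF cN] b c cd cN P[OF cN] K_eq
      by (auto simp: nilp_def sq_carrier simp del: index_mult_mat(1) assoc_mult_mat)
  qed
  have P_unip: "1\<^sub>m n + P (u - 1\<^sub>m n) \<in> unip" if u: "u \<in> unip" for u
  proof -
    define N where "N = u - 1\<^sub>m n"
    have N: "nilp N" using u by (simp add: unip_def N_def)
    note cN = nilp_carrier[OF N]
    obtain u' where u': "u' \<in> G" "u * u' = 1\<^sub>m n" using G_obtain_inverse[OF unip_G[OF u]] by metis
    note cu = unip_carrier[OF u] G_carrier[OF u'(1)]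
    define N2 where "N2 = u' - 1\<^sub>m n"
    have cN2: "N2 \<in> carrier_mat n n" using cu by (simp add: N2_def minus_carrier_mat)
    have adj_N: "adjoint N N2"
      unfolding N_def N2_def by (rule adjoint_minus[OF G_adjoint[OF unip_G[OF u] cu(2) u'(2)] adjoint_one])
    have "N * N2 = (u * u' - u') - (u - 1\<^sub>m n)"
      unfolding N_def N2_def using cu
      by (simp add: minus_mult_distrib_mat[of _ n n _ _ n] mult_minus_distrib_mat[of _ n n _ n] minus_carrier_mat sq_carrier)
    also have "\<dots> = - N - N2" unfolding u'(2) N_def N2_def using cu by (intro eq_matI) auto
    finally have NN2: "N * N2 = - N - N2" .
    have d_c: "d * c = 0\<^sub>m n n" by (rule mult_c[OF cd]) (use d_zero pq in auto)
    \<comment> \<open>The right factor is the adjoint of the left one. The relations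
      \<open>d * d = 0\<close> and \<open>d * N2 = 0\<close> are the adjoints of
      \<open>c * c = 0\<close> and \<open>N * c = 0\<close>.\<close>
    have prod: "(1\<^sub>m n + P N) * (1\<^sub>m n + ((1\<^sub>m n - c * (1\<^sub>m n - b)) * (N2 * (1\<^sub>m n + (1\<^sub>m n - b) * d) + d) - c)) = 1\<^sub>m n"
      unfolding P_def K_def s_def tt_def
      by (rule mat_unit_perturbation[OF c cd b cN cN2 N_c[OF nilp_c] N_c[OF N] d_c
            d_ann[OF d N_c[OF nilp_c]] d_ann[OF adj_N N_c[OF N]] NN2])
    have "adjoint (P N) ((1\<^sub>m n - c * (1\<^sub>m n - b)) * (N2 * (1\<^sub>m n + (1\<^sub>m n - b) * d) + d) - c)"
      unfolding P_def K_def s_def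
      by (intro adjoint_minus[OF _ adjoint_sym[OF d]] adjoint_mult[OF _ adj_tt] adjoint_add[OF _ d]
          adjoint_mult[OF _ adj_N] adjoint_add[OF adjoint_one] adjoint_mult[OF d adj_b])
    then have "1\<^sub>m n + P N \<in> G"
      using adjoint_imp_G[OF adjoint_add[OF adjoint_one] prod] by blast
    then show ?thesis using nilp_P[OF N] P[OF cN] by (simp add: unip_def minus_one_plus flip: N_def)
  qed
  have inj: "inj_on (\<lambda>u. 1\<^sub>m n + P (u - 1\<^sub>m n)) unip"
  proof (rule inj_onI)
    fix u v assume u: "u \<in> unip" and v: "v \<in> unip" and eq: "1\<^sub>m n + P (u - 1\<^sub>m n) = 1\<^sub>m n + P (v - 1\<^sub>m n)"
    have N: "u - 1\<^sub>m n \<in> carrier_mat n n" "v - 1\<^sub>m n \<in> carrier_mat n n"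
      using unip_carrier[OF u] unip_carrier[OF v] by (auto simp: minus_carrier_mat)
    note sN = mult_carrier_mat[OF s N(1)] mult_carrier_mat[OF s N(2)]
    have "P (u - 1\<^sub>m n) = P (v - 1\<^sub>m n)" by (rule one_plus_cancel_mat[OF P[OF N(1)] P[OF N(2)] eq])
    then have "K (u - 1\<^sub>m n) * tt = K (v - 1\<^sub>m n) * tt"
      unfolding P_def by (rule minus_right_cancel_mat[OF mult_carrier_mat[OF K[OF N(1)] tt] mult_carrier_mat[OF K[OF N(2)] tt] cd])
    then have "K (u - 1\<^sub>m n) = K (v - 1\<^sub>m n)"
      by (rule mult_right_cancel_mat[OF tt det_tt0 K[OF N(1)] K[OF N(2)]])
    then have "s * (u - 1\<^sub>m n) = s * (v - 1\<^sub>m n)"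
      unfolding K_def by (rule add_right_cancel_mat[OF sN c])
    then have "u - 1\<^sub>m n = v - 1\<^sub>m n"
      using mult_left_cancel_mat[OF s _ N] det_s y1 by blast
    then show "u = v"
      by (rule minus_right_cancel_mat[OF unip_carrier[OF u] unip_carrier[OF v] one_carrier_mat])
  qed
  have det_u: "det (1\<^sub>m n + g * u) = det (1\<^sub>m n + g) * det (1\<^sub>m n + b * (u - 1\<^sub>m n))" if u: "u \<in> carrier_mat n n" for u
  proof -
    have cu: "u - 1\<^sub>m n \<in> carrier_mat n n" using u by (simp add: minus_carrier_mat)
    have "(1\<^sub>m n + g) * (1\<^sub>m n + b * (u - 1\<^sub>m n)) = (1\<^sub>m n + g) + ((1\<^sub>m n + g) * b) * (u - 1\<^sub>m n)"
      using c1g b cu by (simp add: mult_add_distrib_mat[of _ n n _ n] sq_assoc sq_carrier right_mult_one_mat[OF c1g(1)])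
    also have "\<dots> = (1\<^sub>m n + g) + (g * u - g)"
      unfolding gb using cg u by (simp add: mult_minus_distrib_mat[of _ n n _ n])
    also have "\<dots> = 1\<^sub>m n + g * u" using cg u by (intro eq_matI) (auto simp: sq_carrier simp del: index_mult_mat(1))
    finally show ?thesis
      using det_mult[OF c1g(1), of "1\<^sub>m n + b * (u - 1\<^sub>m n)"] b cu by (simp add: sq_carrier)
  qed
  have "det (1\<^sub>m n + g * (1\<^sub>m n + P (u - 1\<^sub>m n))) = x * cj x * det (1\<^sub>m n + g * u)" if u: "u \<in> unip" for u
  proof -
    have N: "u - 1\<^sub>m n \<in> carrier_mat n n" using unip_carrier[OF u] by (simp add: minus_carrier_mat)
    have bN: "1\<^sub>m n + b * (u - 1\<^sub>m n) \<in> carrier_mat n n" using b N by (simp add: sq_carrier)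
    have bc': "1\<^sub>m n + b * c \<in> carrier_mat n n" using bc by simp
    have "1\<^sub>m n + b * P (u - 1\<^sub>m n) = (1\<^sub>m n + b * c) * (1\<^sub>m n + b * (u - 1\<^sub>m n)) * tt"
      unfolding P_def K_def s_def tt_def by (rule mat_perturbation_factorization[OF c cd b N, symmetric])
    then have "det (1\<^sub>m n + b * P (u - 1\<^sub>m n)) = y1 * det (1\<^sub>m n + b * (u - 1\<^sub>m n)) * det tt"
      using det_mult[OF mult_carrier_mat[OF bc' bN] tt] det_mult[OF bc' bN] det_bc by simp
    also have "\<dots> = x * cj x * det (1\<^sub>m n + b * (u - 1\<^sub>m n))" unfolding det_tt[symmetric] by (simp only: mult_ac)
    finally show ?thesis
      using det_u[OF unip_carrier[OF u]] det_u[of "1\<^sub>m n + P (u - 1\<^sub>m n)"] P[OF N] by (simp add: minus_one_plus)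
  qed
  moreover have "bij_betw (\<lambda>u. 1\<^sub>m n + P (u - 1\<^sub>m n)) unip unip"
    unfolding bij_betw_def using inj P_unip by (auto intro!: endo_inj_surj[OF finite_unip])
  ultimately show ?thesis by (intro exI[of _ "\<lambda>u. 1\<^sub>m n + P (u - 1\<^sub>m n)"]) blast
qed

section \<open>The parabolic subgroup and sums of the class function over cosets of U\<close>

lemma G_subset: "G \<subseteq> {A \<in> carrier_mat n n. det A \<noteq> 0}"
  by (auto simp: isom_group_def)

lemma one_in_unip: "1\<^sub>m n \<in> unip"
proof -
  have "(1\<^sub>m n - 1\<^sub>m n :: 'e mat) = 0\<^sub>m n n" by (intro eq_matI) auto
  then show ?thesis using one_in_G by (simp add: unip_def nilp_def minus_carrier_mat)
qed

lemma unip_subset: "unip \<subseteq> {A \<in> carrier_mat n n. det A \<noteq> 0}"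
  using G_subset by (auto simp: unip_def)

lemma parabolic_G: "p \<in> parabolic cj k m n M \<Longrightarrow> p \<in> G"
  by (simp add: parabolic_def)

lemma parabolic_carrier: "p \<in> parabolic cj k m n M \<Longrightarrow> p \<in> carrier_mat n n"
  using parabolic_G G_carrier by blast

lemma parabolic_index:
  "p \<in> parabolic cj k m n M \<Longrightarrow> i < n \<Longrightarrow> j < n \<Longrightarrow> blk k m j < blk k m i \<Longrightarrow> p $$ (i, j) = 0"
  by (simp add: parabolic_def)

lemma parabolic_subset: "parabolic cj k m n M \<subseteq> {A \<in> carrier_mat n n. det A \<noteq> 0}"
  using G_subset by (auto simp: parabolic_def)

lemma finite_parabolic: "finite (parabolic cj k m n M)"
  by (rule finite_subset[OF _ finite_G]) (auto simp: parabolic_def)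

lemma one_in_parabolic: "1\<^sub>m n \<in> parabolic cj k m n M"
  using one_in_G by (auto simp: parabolic_def)

lemma parabolic_mult:
  assumes p: "p \<in> parabolic cj k m n M" and q: "q \<in> parabolic cj k m n M"
  shows "p * q \<in> parabolic cj k m n M"
  unfolding parabolic_def
proof (intro CollectI conjI allI impI G_mult parabolic_G p q)
  fix i j assume ij: "i < n" "j < n" "blk k m j < blk k m i"
  show "(p * q) $$ (i, j) = 0"
  proof (rule mult_mat_zero_terms[OF parabolic_carrier[OF p] parabolic_carrier[OF q] ij(1,2)])
    fix l assume "l < n"
    then show "p $$ (i, l) = 0 \<or> q $$ (l, j) = 0"
      using parabolic_index[OF p ij(1), of l] parabolic_index[OF q _ ij(2), of l] ij
      by (cases "blk k m l < blk k m i") auto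
  qed
qed

lemma parabolic_inverse:
  assumes "p \<in> parabolic cj k m n M" "p' \<in> carrier_mat n n" "p * p' = 1\<^sub>m n"
  shows "p' \<in> parabolic cj k m n M"
  by (rule finite_mat_monoid_inverse[OF finite_parabolic parabolic_subset one_in_parabolic parabolic_mult assms])

definition phi :: "('e \<Rightarrow> 'c::field) \<Rightarrow> 'e mat \<Rightarrow> 'c" where
  "phi chi g = (if g \<in> isom_group0 cj eps n M \<and> det (1\<^sub>m n + g) \<noteq> 0 then chi (det (1\<^sub>m n + g)) else 0)"

lemma isom_group0_iff:
  "g \<in> isom_group0 cj eps n M \<longleftrightarrow> g \<in> G \<and> (cj = id \<and> eps = 1 \<and> nondeg M \<longrightarrow> det g = 1)"
  by (auto simp: isom_group0_def)

lemma phi_sum_unip: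
  assumes chi: "character chi" and x: "x \<noteq> 0" "chi (x * cj x) \<noteq> 1"
    and g: "g \<in> G" "g \<notin> parabolic cj k m n M"
  shows "(\<Sum>u\<in>unip. phi chi (g * u)) = 0"
proof (cases "\<exists>u\<in>unip. g * u \<in> isom_group0 cj eps n M \<and> det (1\<^sub>m n + g * u) \<noteq> 0")
  case False
  then show ?thesis by (intro sum.neutral) (auto simp: phi_def)
next
  case True
  \<comment> \<open>\<open>unip_rescaling\<close> needs an invertible \<open>1 + g\<close>, which
    may fail at the given \<open>g\<close> although some term of the sum is nonzero. The base point
    of the coset is moved to such a term.\<close>
  then obtain u0 where u0: "u0 \<in> unip" and gu: "g * u0 \<in> isom_group0 cj eps n M" "det (1\<^sub>m n + g * u0) \<noteq> 0" by blast
  define g0 where "g0 = g * u0"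
  have g0: "g0 \<in> G" using G_mult[OF g(1) unip_G[OF u0]] by (simp add: g0_def)
  note c = G_carrier[OF g(1)] unip_carrier[OF u0] G_carrier[OF g0]
  have "g0 \<notin> parabolic cj k m n M"
  proof
    assume P: "g0 \<in> parabolic cj k m n M"
    obtain u' where u': "u' \<in> G" "u0 * u' = 1\<^sub>m n" using G_obtain_inverse[OF unip_G[OF u0]] by metis
    have cu': "u' \<in> carrier_mat n n" using G_carrier[OF u'(1)] .
    have "g0 * u' = g" unfolding g0_def using c cu' u'(2) by (simp add: sq_assoc)
    moreover have "u' \<in> parabolic cj k m n M" by (rule parabolic_inverse[OF unip_levi(1)[OF u0] cu' u'(2)])
    ultimately show False using parabolic_mult[OF P] g(2) by metis
  qed
  then obtain T where T: "bij_betw T unip unip"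
    "\<And>u. u \<in> unip \<Longrightarrow> det (1\<^sub>m n + g0 * T u) = x * cj x * det (1\<^sub>m n + g0 * u)"
    using unip_rescaling[OF g0 _ _ x(1)] gu(2) unfolding g0_def by blast
  \<comment> \<open>Unipotent elements have determinant 1, so the whole coset stays in
    \<open>isom_group0\<close> and only the determinant of \<open>1 + g0 u\<close> matters for
    \<open>phi\<close>.\<close>
  have in0: "g0 * u \<in> isom_group0 cj eps n M" if "u \<in> unip" for u
    using gu(1) G_mult[OF g0 unip_G[OF that]] unip_det[OF that] c unip_carrier[OF that]
    by (auto simp: isom_group0_iff g0_def[symmetric] det_mult[of _ n])
  have y: "x * cj x \<noteq> 0" using x(1) by simp
  have scale: "phi chi (g0 * T u) = chi (x * cj x) * phi chi (g0 * u)" if u: "u \<in> unip" for u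
  proof -
    have Tu: "T u \<in> unip" using T(1) u by (auto simp: bij_betw_def)
    show ?thesis
      using in0[OF u] in0[OF Tu] T(2)[OF u] y chi by (auto simp: phi_def character_def)
  qed
  have "(\<Sum>u\<in>unip. phi chi (g * u)) = (\<Sum>u\<in>unip. phi chi (g * (u0 * u)))"
    by (rule sum.reindex_bij_betw[OF finite_mat_monoid_translate(1)[OF finite_unip unip_subset unip_mult u0], symmetric])
  also have "\<dots> = (\<Sum>u\<in>unip. phi chi (g0 * u))"
    using c unip_carrier by (intro sum.cong) (auto simp: g0_def sq_assoc)
  finally have eq: "(\<Sum>u\<in>unip. phi chi (g * u)) = (\<Sum>u\<in>unip. phi chi (g0 * u))" .
  have "(\<Sum>u\<in>unip. phi chi (g0 * u)) = (\<Sum>u\<in>unip. phi chi (g0 * T u))"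
    by (rule sum.reindex_bij_betw[OF T(1), symmetric])
  also have "\<dots> = chi (x * cj x) * (\<Sum>u\<in>unip. phi chi (g0 * u))"
    by (simp add: scale sum_distrib_left)
  finally have "(chi (x * cj x) - 1) * (\<Sum>u\<in>unip. phi chi (g0 * u)) = 0" by (simp add: algebra_simps)
  then show ?thesis using x(2) eq by simp
qed

lemma phi_conj:
  assumes g: "g \<in> G" and h: "h \<in> G" and h': "h' \<in> G" "h * h' = 1\<^sub>m n"
  shows "phi chi (h * g * h') = phi chi g"
proof -
  note c = G_carrier[OF g] G_carrier[OF h] G_carrier[OF h'(1)]
  have dd: "det h * det h' = 1" using det_mult[OF c(2,3)] h'(2) by simp
  have "h * (1\<^sub>m n + g) * h' = h * h' + h * g * h'"
    using c by (simp add: add_mult_distrib_mat[of _ n n _ _ n] mult_add_distrib_mat[of _ n n _ n] sq_carrier del: assoc_mult_mat)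
  then have "det (1\<^sub>m n + h * g * h') = det (h * (1\<^sub>m n + g) * h')" unfolding h'(2) by (simp only:)
  also have "\<dots> = det h * det (1\<^sub>m n + g) * det h'"
    using c det_mult[of "h * (1\<^sub>m n + g)" n h'] det_mult[of h n "1\<^sub>m n + g"] by (simp add: sq_carrier del: assoc_mult_mat)
  also have "\<dots> = det (1\<^sub>m n + g)" using dd by (simp add: mult_ac)
  finally have d1: "det (1\<^sub>m n + h * g * h') = det (1\<^sub>m n + g)" .
  have "det (h * g * h') = det h * det g * det h'"
    using c det_mult[of "h * g" n h'] det_mult[of h n g] by (simp add: sq_carrier del: assoc_mult_mat)
  then have d2: "det (h * g * h') = det g" using dd by (simp add: mult_ac)
  have "h * g * h' \<in> G" using G_mult g h h'(1) by blast
  then show ?thesis using g by (simp only: phi_def isom_group0_iff d1 d2)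
qed

text \<open>\<open>g * h\<close> and \<open>h * g\<close> are conjugate by \<open>h\<close>. The
  class function property is used in this form, which trades left translates for right ones.\<close>

lemma phi_swap:
  assumes g: "g \<in> G" and h: "h \<in> G"
  shows "phi chi (g * h) = phi chi (h * g)"
proof -
  obtain h' where h': "h' \<in> G" "h * h' = 1\<^sub>m n" "h' * h = 1\<^sub>m n" using G_obtain_inverse[OF h] .
  note c = G_carrier[OF g] G_carrier[OF h] G_carrier[OF h'(1)]
  have "h * (g * h) * h' = h * g * (h * h')" using c by (simp add: sq_assoc sq_carrier)
  then have "h * (g * h) * h' = h * g" unfolding h'(2) using c by (simp add: sq_carrier)
  then show ?thesis using phi_conj[OF G_mult[OF g h] h h'(1,2), of chi] by simp
qed

subsection \<open>The Levi subgroup\<close>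

lemma levi_X_mult:
  assumes p: "p \<in> parabolic cj k m n M" and q: "q \<in> parabolic cj k m n M"
  shows "levi_X k (p * q) = levi_X k p * levi_X k q"
proof (rule eq_matI)
  fix i j assume "i < dim_row (levi_X k p * levi_X k q)" "j < dim_col (levi_X k p * levi_X k q)"
  then have ij: "i < k" "j < k" by (auto simp: levi_X_def)
  have "levi_X k (p * q) $$ (i, j) = (\<Sum>l<n. p $$ (i, l) * q $$ (l, j))"
    using ij kk_le parabolic_carrier[OF p] parabolic_carrier[OF q]
    by (simp add: levi_X_def mult_mat_index_lessThan[of _ n n _ n] del: index_mult_mat(1))
  also have "\<dots> = (\<Sum>l<k. p $$ (i, l) * q $$ (l, j))"
  proof (rule sum.mono_neutral_right)
    show "\<forall>l\<in>{..<n} - {..<k}. p $$ (i, l) * q $$ (l, j) = 0"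
      using parabolic_index[OF q] ij kk_le by (auto simp: blk_def)
  qed (use kk_le in auto)
  also have "\<dots> = (levi_X k p * levi_X k q) $$ (i, j)"
    using ij by (subst mult_mat_index_lessThan[of _ k k _ k]) (auto simp: levi_X_def)
  finally show "levi_X k (p * q) $$ (i, j) = (levi_X k p * levi_X k q) $$ (i, j)" .
qed (auto simp: levi_X_def)

lemma levi_0_mult:
  assumes p: "p \<in> parabolic cj k m n M" and q: "q \<in> parabolic cj k m n M"
  shows "levi_0 k m (p * q) = levi_0 k m p * levi_0 k m q"
proof (rule eq_matI)
  fix i j assume "i < dim_row (levi_0 k m p * levi_0 k m q)" "j < dim_col (levi_0 k m p * levi_0 k m q)"
  then have ij: "i < m" "j < m" by (auto simp: levi_0_def)
  then have ij': "k + i < n" "k + j < n" using km_le by auto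
  have "levi_0 k m (p * q) $$ (i, j) = (\<Sum>l<n. p $$ (k + i, l) * q $$ (l, k + j))"
    using ij ij' parabolic_carrier[OF p] parabolic_carrier[OF q]
    by (simp add: levi_0_def mult_mat_index_lessThan[of _ n n _ n] del: index_mult_mat(1))
  also have "\<dots> = (\<Sum>l<n. if k \<le> l \<and> l < k + m then p $$ (k + i, l) * q $$ (l, k + j) else 0)"
  proof (rule sum.cong[OF refl])
    fix l assume "l \<in> {..<n}"
    then show "p $$ (k + i, l) * q $$ (l, k + j) = (if k \<le> l \<and> l < k + m then p $$ (k + i, l) * q $$ (l, k + j) else 0)"
      using parabolic_index[OF p ij'(1), of l] parabolic_index[OF q _ ij'(2), of l] ij by (auto simp: blk_def)
  qed
  also have "\<dots> = (\<Sum>l<m. p $$ (k + i, k + l) * q $$ (k + l, k + j))" by (rule sum_mid[OF km_le])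
  also have "\<dots> = (levi_0 k m p * levi_0 k m q) $$ (i, j)"
    using ij by (subst mult_mat_index_lessThan[of _ m m _ m]) (auto simp: levi_0_def)
  finally show "levi_0 k m (p * q) $$ (i, j) = (levi_0 k m p * levi_0 k m q) $$ (i, j)" .
qed (auto simp: levi_0_def)

lemma levi_det:
  assumes p: "p \<in> parabolic cj k m n M"
  shows "det (levi_X k p) \<noteq> 0" "det (levi_0 k m p) \<noteq> 0"
proof -
  obtain p' where p': "p' \<in> G" "p * p' = 1\<^sub>m n" using G_obtain_inverse[OF parabolic_G[OF p]] by metis
  have q: "p' \<in> parabolic cj k m n M" by (rule parabolic_inverse[OF p G_carrier[OF p'(1)] p'(2)])
  have X: "levi_X k (1\<^sub>m n) = (1\<^sub>m k :: 'e mat)" and Z: "levi_0 k m (1\<^sub>m n) = (1\<^sub>m m :: 'e mat)"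
    using unip_levi[OF one_in_unip] by auto
  show "det (levi_X k p) \<noteq> 0"
    by (rule mult_one_imp_det_nonzero[of _ k "levi_X k p'"])
      (use levi_X_mult[OF p q] p'(2) X in \<open>auto simp: levi_X_def\<close>)
  show "det (levi_0 k m p) \<noteq> 0"
    by (rule mult_one_imp_det_nonzero[of _ m "levi_0 k m p'"])
      (use levi_0_mult[OF p q] p'(2) Z in \<open>auto simp: levi_0_def\<close>)
qed

lemma GL_iff: "a \<in> isom_group cj l (0\<^sub>m l l) \<longleftrightarrow> a \<in> carrier_mat l l \<and> det a \<noteq> 0"
  by (auto simp: isom_group_def sesq_def)

lemma levi_X_GL: "p \<in> parabolic cj k m n M \<Longrightarrow> levi_X k p \<in> isom_group cj k (0\<^sub>m k k)"
  using levi_det by (simp add: GL_iff) (simp add: levi_X_def)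

text \<open>V is the orthogonal sum of X + Y and V0. The guards in the first summand make it depend
  only on coordinates outside V0, which lifts from V0 leave unchanged.\<close>

lemma sesq_split:
  "sesq cj M x y =
    (\<Sum>i<n. \<Sum>j<n. if (i < k \<or> k + m \<le> i) \<and> (j < k \<or> k + m \<le> j) then x $ i * M $$ (i, j) * cj (y $ j) else 0)
    + sesq cj (gram0 k m M) (vec m (\<lambda>i. x $ (k + i))) (vec m (\<lambda>i. y $ (k + i)))"
proof -
  let ?t = "\<lambda>i j. x $ i * M $$ (i, j) * cj (y $ j)"
  let ?out = "\<lambda>i. i < k \<or> k + m \<le> i" and ?mid = "\<lambda>i. k \<le> i \<and> i < k + m"
  have "sesq cj M x y = (\<Sum>i<n. \<Sum>j<n. (if ?out i \<and> ?out j then ?t i j else 0)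
      + (if ?mid i then if ?mid j then ?t i j else 0 else 0))"
    unfolding sesq_def dim_M
    by (intro sum.cong refl) (auto simp: not_less not_le M_V0_out M_out_V0)
  also have "\<dots> = (\<Sum>i<n. \<Sum>j<n. if ?out i \<and> ?out j then ?t i j else 0)
      + (\<Sum>i<n. if ?mid i then \<Sum>j<n. if ?mid j then ?t i j else 0 else 0)"
    by (simp add: sum.distrib) (intro sum.cong refl, auto)
  also have "(\<Sum>i<n. if ?mid i then \<Sum>j<n. if ?mid j then ?t i j else 0 else 0)
      = (\<Sum>i<m. \<Sum>j<m. ?t (k + i) (k + j))"
    by (simp only: sum_mid[OF km_le])
  also have "\<dots> = sesq cj (gram0 k m M) (vec m (\<lambda>i. x $ (k + i))) (vec m (\<lambda>i. y $ (k + i)))"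
    by (auto simp: sesq_def gram0_def levi_0_def intro!: sum.cong)
  finally show ?thesis .
qed

lemma mult_vec_index: "A \<in> carrier_mat a b \<Longrightarrow> v \<in> carrier_vec b \<Longrightarrow> i < a \<Longrightarrow>
    (A *\<^sub>v v) $ i = (\<Sum>l<b. A $$ (i, l) * v $ l)"
  by (simp add: scalar_prod_def atLeast0LessThan)

text \<open>\<open>p\<close> maps V0 into X + V0, and the X-component is orthogonal to X + V0. Only
  the V0-component, given by \<open>levi_0\<close>, contributes to the form.\<close>

lemma levi_0_isometry:
  assumes p: "p \<in> parabolic cj k m n M"
  shows "levi_0 k m p \<in> isom_group cj m (gram0 k m M)"
proof -
  note c = parabolic_carrier[OF p]
  let ?e = "\<lambda>x. vec n (\<lambda>i. if k \<le> i \<and> i < k + m then x $ (i - k) else 0)"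
  have c0: "levi_0 k m p \<in> carrier_mat m m" by (simp add: levi_0_def)
  have mid_e: "vec m (\<lambda>i. ?e x $ (k + i)) = x" if "x \<in> carrier_vec m" for x :: "'e vec"
    using that km_le by (intro eq_vecI) auto
  have p_e: "(p *\<^sub>v ?e x) $ i = (\<Sum>l<m. p $$ (i, k + l) * x $ l)" if "i < n" "x \<in> carrier_vec m" for x i
  proof -
    have "(p *\<^sub>v ?e x) $ i = (\<Sum>l<n. p $$ (i, l) * ?e x $ l)" using c that by (intro mult_vec_index) auto
    also have "\<dots> = (\<Sum>l<n. if k \<le> l \<and> l < k + m then p $$ (i, l) * x $ (l - k) else 0)"
      by (intro sum.cong) auto
    finally show ?thesis by (simp add: sum_mid[OF km_le])
  qed
  have mid_p: "vec m (\<lambda>i. (p *\<^sub>v ?e x) $ (k + i)) = levi_0 k m p *\<^sub>v x" if x: "x \<in> carrier_vec m" for x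
  proof (rule eq_vecI)
    fix i assume "i < dim_vec (levi_0 k m p *\<^sub>v x)"
    then have i: "i < m" using c0 by simp
    then have "(levi_0 k m p *\<^sub>v x) $ i = (\<Sum>l<m. levi_0 k m p $$ (i, l) * x $ l)"
      by (intro mult_vec_index[OF c0 x])
    also have "\<dots> = (\<Sum>l<m. p $$ (k + i, k + l) * x $ l)" using i by (intro sum.cong) (auto simp: levi_0_def)
    finally show "vec m (\<lambda>i. (p *\<^sub>v ?e x) $ (k + i)) $ i = (levi_0 k m p *\<^sub>v x) $ i"
      using i km_le p_e[OF _ x, of "k + i"] by (simp del: index_mult_mat_vec)
  qed (use c0 in simp)
  have Y: "(p *\<^sub>v ?e x) $ i = 0" if "k + m \<le> i" "i < n" "x \<in> carrier_vec m" for x i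
    unfolding p_e[OF that(2,3)]
    using parabolic_index[OF p that(2)] that by (intro sum.neutral) (auto simp: blk_def)
  have "sesq cj (gram0 k m M) (levi_0 k m p *\<^sub>v x) (levi_0 k m p *\<^sub>v y) = sesq cj (gram0 k m M) x y"
    if x: "x \<in> carrier_vec m" and y: "y \<in> carrier_vec m" for x y
  proof -
    have "sesq cj M (p *\<^sub>v ?e x) (p *\<^sub>v ?e y) = sesq cj (gram0 k m M) (levi_0 k m p *\<^sub>v x) (levi_0 k m p *\<^sub>v y)"
      unfolding sesq_split[of "p *\<^sub>v ?e x"] mid_p[OF x] mid_p[OF y]
    proof -
      have "(\<Sum>i<n. \<Sum>j<n. if (i < k \<or> k + m \<le> i) \<and> (j < k \<or> k + m \<le> j)
          then (p *\<^sub>v ?e x) $ i * M $$ (i, j) * cj ((p *\<^sub>v ?e y) $ j) else 0) = 0"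
        by (intro sum.neutral ballI) (auto simp: Y x y M_X_Xperp simp del: index_mult_mat_vec)
      then show "(\<Sum>i<n. \<Sum>j<n. if (i < k \<or> k + m \<le> i) \<and> (j < k \<or> k + m \<le> j)
          then (p *\<^sub>v ?e x) $ i * M $$ (i, j) * cj ((p *\<^sub>v ?e y) $ j) else 0)
          + sesq cj (gram0 k m M) (levi_0 k m p *\<^sub>v x) (levi_0 k m p *\<^sub>v y)
          = sesq cj (gram0 k m M) (levi_0 k m p *\<^sub>v x) (levi_0 k m p *\<^sub>v y)" by simp
    qed
    moreover have "sesq cj M (?e x) (?e y) = sesq cj (gram0 k m M) x y"
      unfolding sesq_split[of "?e x"] mid_e[OF x] mid_e[OF y]
    proof -
      have "(\<Sum>i<n. \<Sum>j<n. if (i < k \<or> k + m \<le> i) \<and> (j < k \<or> k + m \<le> j)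
          then ?e x $ i * M $$ (i, j) * cj (?e y $ j) else 0) = 0"
        by (intro sum.neutral ballI) auto
      then show "(\<Sum>i<n. \<Sum>j<n. if (i < k \<or> k + m \<le> i) \<and> (j < k \<or> k + m \<le> j)
          then ?e x $ i * M $$ (i, j) * cj (?e y $ j) else 0) + sesq cj (gram0 k m M) x y = sesq cj (gram0 k m M) x y"
        by simp
    qed
    moreover have "sesq cj M (p *\<^sub>v ?e x) (p *\<^sub>v ?e y) = sesq cj M (?e x) (?e y)"
      using parabolic_G[OF p] by (simp add: isom_group_def)
    ultimately show ?thesis by simp
  qed
  then show ?thesis using levi_det(2)[OF p] c0 by (simp add: isom_group_def)
qed

lemma lift_V0:
  assumes b: "b \<in> isom_group cj m (gram0 k m M)"
  obtains p where "p \<in> parabolic cj k m n M" "levi_X k p = 1\<^sub>m k" "levi_0 k m p = b"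
proof -
  define p where "p = embed_block n k m b"
  have cb: "b \<in> carrier_mat m m" "det b \<noteq> 0" using b by (auto simp: isom_group_def)
  have c: "p \<in> carrier_mat n n" by (simp add: p_def)
  have px: "(p *\<^sub>v x) $ i = (if k \<le> i \<and> i < k + m then (\<Sum>l<m. b $$ (i - k, l) * x $ (k + l)) else x $ i)"
    if "x \<in> carrier_vec n" "i < n" for x i
    unfolding mult_vec_index[OF c that] unfolding p_def by (rule embed_block_mult_vec[OF km_le cb(1) that(2)])
  have mid: "vec m (\<lambda>i. (p *\<^sub>v x) $ (k + i)) = b *\<^sub>v vec m (\<lambda>i. x $ (k + i))" if x: "x \<in> carrier_vec n" for x
  proof (rule eq_vecI)
    fix i assume "i < dim_vec (b *\<^sub>v vec m (\<lambda>i. x $ (k + i)))"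
    then have i: "i < m" using cb by simp
    then have "(b *\<^sub>v vec m (\<lambda>i. x $ (k + i))) $ i = (\<Sum>l<m. b $$ (i, l) * vec m (\<lambda>i. x $ (k + i)) $ l)"
      by (intro mult_vec_index[OF cb(1)]) auto
    then show "vec m (\<lambda>i. (p *\<^sub>v x) $ (k + i)) $ i = (b *\<^sub>v vec m (\<lambda>i. x $ (k + i))) $ i"
      using i km_le px[OF x, of "k + i"] by (simp del: index_mult_mat_vec)
  qed (use cb in simp)
  have "sesq cj M (p *\<^sub>v x) (p *\<^sub>v y) = sesq cj M x y" if x: "x \<in> carrier_vec n" and y: "y \<in> carrier_vec n" for x y
  proof -
    have "sesq cj (gram0 k m M) (b *\<^sub>v vec m (\<lambda>i. x $ (k + i))) (b *\<^sub>v vec m (\<lambda>i. y $ (k + i)))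
      = sesq cj (gram0 k m M) (vec m (\<lambda>i. x $ (k + i))) (vec m (\<lambda>i. y $ (k + i)))"
      using b by (simp add: isom_group_def)
    moreover have "(\<Sum>i<n. \<Sum>j<n. if (i < k \<or> k + m \<le> i) \<and> (j < k \<or> k + m \<le> j)
          then (p *\<^sub>v x) $ i * M $$ (i, j) * cj ((p *\<^sub>v y) $ j) else 0)
        = (\<Sum>i<n. \<Sum>j<n. if (i < k \<or> k + m \<le> i) \<and> (j < k \<or> k + m \<le> j)
          then x $ i * M $$ (i, j) * cj (y $ j) else 0)"
      by (intro sum.cong refl) (auto simp: px x y simp del: index_mult_mat_vec)
    ultimately show ?thesis unfolding sesq_split[of "p *\<^sub>v x"] mid[OF x] mid[OF y] sesq_split[of x] by simp
  qed
  then have "p \<in> G" using c embed_block_det[OF km_le cb] by (simp add: isom_group_def p_def)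
  then have "p \<in> parabolic cj k m n M"
    by (auto simp: parabolic_def p_def embed_block_def blk_def split: if_splits)
  moreover have "levi_X k p = 1\<^sub>m k" using kk_le by (intro eq_matI) (auto simp: levi_X_def p_def embed_block_def)
  moreover have "levi_0 k m p = b" using cb km_le by (intro eq_matI) (auto simp: levi_0_def p_def embed_block_def)
  ultimately show thesis by (rule that)
qed

text \<open>For a nondegenerate form, diag(a, 1, 1) needs a correction on Y, the inverse of the
  adjoint action of \<open>a\<close>. It is produced as the adjoint \<open>C\<close> of the inverse
  \<open>A'\<close>; the duality between X and Y confines \<open>C - 1\<close> to the Y
  block.\<close>

lemma lift_X:
  assumes a: "a \<in> isom_group cj k (0\<^sub>m k k)"
  obtains p where "p \<in> parabolic cj k m n M" "levi_X k p = a" "levi_0 k m p = 1\<^sub>m m"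
proof -
  have ca: "a \<in> carrier_mat k k" "det a \<noteq> 0" using a by (auto simp: GL_iff)
  have le: "0 + k \<le> n" using kk_le by simp
  obtain a' where a': "a' \<in> carrier_mat k k" "a * a' = 1\<^sub>m k" "a' * a = 1\<^sub>m k"
    using det_nonzero_obtain_inverse[OF ca] by metis
  define A A' where "A = embed_block n 0 k a" and "A' = embed_block n 0 k a'"
  have cA: "A \<in> carrier_mat n n" "A' \<in> carrier_mat n n" by (auto simp: A_def A'_def)
  have AA': "A * A' = 1\<^sub>m n" "A' * A = 1\<^sub>m n"
    unfolding A_def A'_def using embed_block_mult[OF le ca(1) a'(1)] embed_block_mult[OF le a'(1) ca(1)] a'
    by (auto simp: embed_block_one)
  have A_index: "A $$ (i, j) = (if i < k \<and> j < k then a $$ (i, j) else if i = j then 1 else 0)"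
    and A'_index: "A' $$ (i, j) = (if i < k \<and> j < k then a' $$ (i, j) else if i = j then 1 else 0)"
    if "i < n" "j < n" for i j
    using that by (auto simp: A_def A'_def embed_block_def)
  \<comment> \<open>\<open>S\<close> is the correction on the Y block; it is 0 for the zero
    form.\<close>
  have "\<exists>p S. p \<in> G \<and> S \<in> carrier_mat n n \<and> p = A + S \<and>
    (\<forall>i<n. \<forall>j<n. i < k + m \<or> j < k + m \<longrightarrow> S $$ (i, j) = 0)"
  proof (cases rule: M_cases)
    case 1
    have "A \<in> G" using cA mult_one_imp_det_nonzero[OF cA AA'(1)] unfolding isom_group_iff by (simp add: 1(2))
    then show ?thesis using cA by (intro exI[of _ A] exI[of _ "0\<^sub>m n n"]) simp
  next
    case 2
    obtain C where C: "adjoint A' C" using adjoint_exists[OF cA(2) 2(2)] .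
    have cC: "C \<in> carrier_mat n n" using adjoint_carrier[OF C] by simp
    have "det C \<noteq> 0" using adjoint_det[OF C 2(2)] mult_one_imp_det_nonzero[OF cA(2,1) AA'(2)] by auto
    then obtain D where D: "D \<in> carrier_mat n n" "C * D = 1\<^sub>m n" using det_nonzero_obtain_inverse[OF cC] by metis
    have adj_A: "adjoint A D" by (rule adjoint_inverse[OF C cA(1) AA'(2) D])
    define S where "S = C - 1\<^sub>m n"
    define R where "R = A' - 1\<^sub>m n"
    define R1 where "R1 = A - 1\<^sub>m n"
    have cS: "S \<in> carrier_mat n n" "R \<in> carrier_mat n n" "R1 \<in> carrier_mat n n"
      using cC cA by (auto simp: S_def R_def R1_def minus_carrier_mat)
    have adj: "R\<^sup>T * M = M * conjm S"
      using adjoint_minus[OF C adjoint_one] by (simp add: adjoint_def R_def S_def)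
    have R_zero: "R $$ (i, j) = 0" if "i < n" "j < n" "k \<le> i \<or> k \<le> j" for i j
      using that A'_index[of i j] cA by (auto simp: R_def)
    have R1_zero: "R1 $$ (i, j) = 0" if "i < n" "j < n" "k \<le> i \<or> k \<le> j" for i j
      using that A_index[of i j] cA by (auto simp: R1_def)
    have MS: "(M *\<^sub>v col (conjm S) j) $ r = (R\<^sup>T * M) $$ (r, j)" if "r < n" "j < n" for r j
      unfolding adj using cS that by simp
    \<comment> \<open>\<open>R\<close> is supported on the X block, so \<open>M\<close> times a
      conjugated column of \<open>S\<close> is supported on X, which puts the column in Y. For
      columns from X + V0 it even vanishes, X being orthogonal to X + V0.\<close>
    have S_row: "S $$ (i, j) = 0" if ij: "i < k + m" "j < n" for i j
    proof -
      have "col (conjm S) j $ i = 0"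
      proof (rule support_of_mult_M_in_X[OF 2(2) _ _ ij(1)])
        show "col (conjm S) j \<in> carrier_vec n" using cS ij by simp
        fix r assume r: "k \<le> r" "r < n"
        have "(R\<^sup>T * M) $$ (r, j) = 0"
          by (rule mult_mat_zero_row[OF _ M_carrier r(2) ij(2)]) (use cS r R_zero in auto)
        then show "(M *\<^sub>v col (conjm S) j) $ r = 0" using MS[OF r(2) ij(2)] by simp
      qed
      then show ?thesis using cS ij km_le by simp
    qed
    have S_col: "S $$ (i, j) = 0" if ij: "i < n" "j < k + m" for i j
    proof -
      have jn: "j < n" using ij km_le by simp
      have "M *\<^sub>v col (conjm S) j = 0\<^sub>v n"
      proof (rule eq_vecI)
        fix r assume "r < dim_vec (0\<^sub>v n)"
        then have r: "r < n" by simp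
        have "(R\<^sup>T * M) $$ (r, j) = 0"
        proof (rule mult_mat_zero_terms[OF _ M_carrier r jn])
          fix l assume "l < n"
          then show "R\<^sup>T $$ (r, l) = 0 \<or> M $$ (l, j) = 0"
            using cS r R_zero[of l r] M_X_Xperp[of l j] ij by (cases "l < k") auto
        qed (use cS in simp)
        then show "(M *\<^sub>v col (conjm S) j) $ r = 0\<^sub>v n $ r" using MS[OF r jn] r by simp
      qed simp
      moreover have "col (conjm S) j \<in> carrier_vec n" using cS jn by simp
      ultimately have "col (conjm S) j = 0\<^sub>v n" using M_kernel[OF 2(2)] by blast
      then have "col (conjm S) j $ i = 0" using ij by simp
      then show ?thesis using cS ij jn by simp
    qed
    \<comment> \<open>\<open>A - 1\<close> lives on the X block and \<open>C - 1\<close> on the Y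
      block, so \<open>A\<close> and \<open>C\<close> commute with product
      \<open>A + S\<close>.\<close>
    have R1S: "R1 * S = 0\<^sub>m n n"
    proof (rule eq_matI)
      fix i j assume "i < dim_row (0\<^sub>m n n :: 'e mat)" "j < dim_col (0\<^sub>m n n :: 'e mat)"
      then have ij: "i < n" "j < n" by auto
      have "(R1 * S) $$ (i, j) = 0"
      proof (rule mult_mat_zero_terms[OF cS(3,1) ij])
        fix l assume "l < n"
        then show "R1 $$ (i, l) = 0 \<or> S $$ (l, j) = 0"
          using R1_zero[of i l] S_row[of l j] ij by (cases "l < k") auto
      qed
      then show "(R1 * S) $$ (i, j) = 0\<^sub>m n n $$ (i, j)" using ij by simp
    qed (use cS in auto)
    have SR1: "S * R1 = 0\<^sub>m n n"
    proof (rule eq_matI)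
      fix i j assume "i < dim_row (0\<^sub>m n n :: 'e mat)" "j < dim_col (0\<^sub>m n n :: 'e mat)"
      then have ij: "i < n" "j < n" by auto
      have "(S * R1) $$ (i, j) = 0"
      proof (rule mult_mat_zero_terms[OF cS(1,3) ij])
        fix l assume "l < n"
        then show "S $$ (i, l) = 0 \<or> R1 $$ (l, j) = 0"
          using R1_zero[of l j] S_col[of i l] ij by (cases "l < k") auto
      qed
      then show "(S * R1) $$ (i, j) = 0\<^sub>m n n $$ (i, j)" using ij by simp
    qed (use cS in auto)
    have A1: "A = 1\<^sub>m n + R1" and C1: "C = 1\<^sub>m n + S"
      using cA cC by (auto simp: R1_def S_def one_plus_minus)
    have AC: "A * C = A + S"
      unfolding C1 A1 using cS R1S
      by (simp add: add_mult_distrib_mat[of _ n n _ _ n] mult_add_distrib_mat[of _ n n _ n] sq_carrier)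
    have CA: "C * A = A + S"
      unfolding C1 A1 using cS SR1
      by (simp add: add_mult_distrib_mat[of _ n n _ _ n] mult_add_distrib_mat[of _ n n _ n] sq_carrier)
        (intro eq_matI; simp)
    \<comment> \<open>\<open>A' * D\<close> is the adjoint of \<open>A * C\<close>, since
      \<open>D\<close> is adjoint to \<open>A\<close> and \<open>A'\<close> to \<open>C\<close>;
      commutation shows that it is also the inverse.\<close>
    have "(A * C) * (A' * D) = (C * A) * (A' * D)" by (simp only: AC CA)
    also have "\<dots> = C * ((A * A') * D)" using cA cC D by (simp add: sq_assoc sq_carrier)
    also have "\<dots> = 1\<^sub>m n" unfolding AA'(1) using D by simp
    finally have "A * C \<in> G"
      by (rule adjoint_imp_G[OF adjoint_mult[OF adj_A adjoint_sym[OF C]]])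
    then show ?thesis using AC cS S_row S_col by (intro exI[of _ "A * C"] exI[of _ S]) auto
  qed
  then obtain p S where p: "p \<in> G" and cS: "S \<in> carrier_mat n n" and pS: "p = A + S"
    and S: "\<And>i j. i < n \<Longrightarrow> j < n \<Longrightarrow> i < k + m \<or> j < k + m \<Longrightarrow> S $$ (i, j) = 0" by blast
  have p_index: "p $$ (i, j) = (if i < k \<and> j < k then a $$ (i, j) else if i = j then 1 else 0)"
    if "i < n" "j < n" "i < k + m \<or> j < k + m" for i j
    using that A_index[of i j] S[of i j] cA cS by (simp add: pS)
  have "p \<in> parabolic cj k m n M"
    using p p_index by (auto simp: parabolic_def blk_def split: if_splits)
  moreover have "levi_X k p = a" using ca kk_le p_index by (intro eq_matI) (auto simp: levi_X_def)
  moreover have "levi_0 k m p = 1\<^sub>m m" using km_le p_index by (intro eq_matI) (auto simp: levi_0_def)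
  ultimately show thesis by (rule that)
qed

end

section \<open>The induced representation\<close>

locale induced_setup = parabolic_space cj eps k m n M
  for cj :: "'e::{field,finite} \<Rightarrow> 'e" and eps k m n M +
  fixes dt d0 :: nat and tau pi0 :: "'e mat \<Rightarrow> 'c::field mat" and chi :: "'e \<Rightarrow> 'c"
  assumes alg: "alg_closed TYPE('c)"
    and irr0: "irrep m (isom_group cj m (gram0 k m M)) d0 pi0"
    and irrX: "irrep k (isom_group cj k (0\<^sub>m k k)) dt tau"
    and chi: "character chi"
    and chi_nontrivial: "\<exists>x. x \<noteq> 0 \<and> chi (x * cj x) \<noteq> 1"
begin

abbreviation Par where "Par \<equiv> parabolic cj k m n M"

definition sigma :: "'e mat \<Rightarrow> 'c mat" where
  "sigma p = kron (tau (levi_X k p)) (pi0 (levi_0 k m p))"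

lemma tau_carrier: "a \<in> isom_group cj k (0\<^sub>m k k) \<Longrightarrow> tau a \<in> carrier_mat dt dt"
  and tau_one: "tau (1\<^sub>m k) = 1\<^sub>m dt"
  and tau_mult: "a \<in> isom_group cj k (0\<^sub>m k k) \<Longrightarrow> a' \<in> isom_group cj k (0\<^sub>m k k) \<Longrightarrow> tau (a * a') = tau a * tau a'"
  using irrX unfolding irrep_def is_rep_def by simp_all

lemma pi0_carrier: "b \<in> isom_group cj m (gram0 k m M) \<Longrightarrow> pi0 b \<in> carrier_mat d0 d0"
  and pi0_one: "pi0 (1\<^sub>m m) = 1\<^sub>m d0"
  and pi0_mult: "b \<in> isom_group cj m (gram0 k m M) \<Longrightarrow> b' \<in> isom_group cj m (gram0 k m M) \<Longrightarrow>
    pi0 (b * b') = pi0 b * pi0 b'"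
  using irr0 unfolding irrep_def is_rep_def by simp_all

lemma sigma_carrier: "p \<in> Par \<Longrightarrow> sigma p \<in> carrier_mat (dt * d0) (dt * d0)"
  unfolding sigma_def using tau_carrier[OF levi_X_GL] pi0_carrier[OF levi_0_isometry] by simp

lemma sigma_mult:
  assumes "p \<in> Par" "q \<in> Par"
  shows "sigma (p * q) = sigma p * sigma q"
  unfolding sigma_def levi_X_mult[OF assms] levi_0_mult[OF assms]
    tau_mult[OF levi_X_GL[OF assms(1)] levi_X_GL[OF assms(2)]]
    pi0_mult[OF levi_0_isometry[OF assms(1)] levi_0_isometry[OF assms(2)]]
  by (rule kron_mult) (use assms in \<open>auto intro: tau_carrier levi_X_GL pi0_carrier levi_0_isometry\<close>)

lemma parabolic_part_scalar:
  "\<exists>c. \<forall>i<dt * d0. \<forall>j<dt * d0. (\<Sum>p\<in>Par. phi chi p * sigma p $$ (i, j)) = (if i = j then c else 0)"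
proof -
  define T where "T = mat (dt * d0) (dt * d0) (\<lambda>(i, j). \<Sum>p\<in>Par. phi chi p * sigma p $$ (i, j))"
  have T: "T \<in> carrier_mat (dt * d0) (dt * d0)" by (simp add: T_def)
  have comm: "T * sigma l = sigma l * T" if l: "l \<in> Par" for l
  proof (rule eq_matI)
    note sl = sigma_carrier[OF l]
    fix i j assume "i < dim_row (sigma l * T)" "j < dim_col (sigma l * T)"
    then have ij: "i < dt * d0" "j < dt * d0" using sl T by auto
    obtain l' where l': "l' \<in> G" "l * l' = 1\<^sub>m n" "l' * l = 1\<^sub>m n" using G_obtain_inverse[OF parabolic_G[OF l]] .
    have l'P: "l' \<in> Par" by (rule parabolic_inverse[OF l G_carrier[OF l'(1)] l'(2)])
    note cl = parabolic_carrier[OF l] G_carrier[OF l'(1)]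
    have "(T * sigma l) $$ (i, j) = (\<Sum>r<dt * d0. \<Sum>p\<in>Par. phi chi p * sigma p $$ (i, r) * sigma l $$ (r, j))"
      unfolding mult_mat_index_lessThan[OF T sl ij] using ij by (simp add: T_def sum_distrib_right)
    also have "\<dots> = (\<Sum>p\<in>Par. phi chi p * (\<Sum>r<dt * d0. sigma p $$ (i, r) * sigma l $$ (r, j)))"
      by (subst sum.swap) (simp add: sum_distrib_left mult.assoc)
    also have "\<dots> = (\<Sum>p\<in>Par. phi chi p * sigma (p * l) $$ (i, j))"
      by (rule sum.cong) (use ij sl sigma_carrier in \<open>auto simp: sigma_mult l mult_mat_index_lessThan[OF sigma_carrier sl] simp del: index_mult_mat(1)\<close>)
    \<comment> \<open>Inserting \<open>l * l'\<close> prepares the substitution of \<open>p\<close>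
      for \<open>p * l\<close>. Then \<open>l'\<close> changes sides because \<open>phi\<close> is a
      class function, and a left translation absorbs it.\<close>
    also have "\<dots> = (\<Sum>p\<in>Par. phi chi (p * l * l') * sigma (p * l) $$ (i, j))"
      by (rule sum.cong) (use cl l'(2) parabolic_carrier in \<open>auto simp: sq_assoc right_mult_one_mat[OF parabolic_carrier]\<close>)
    also have "\<dots> = (\<Sum>p\<in>Par. phi chi (p * l') * sigma p $$ (i, j))"
      by (rule sum.reindex_bij_betw[OF finite_mat_monoid_translate(2)[OF finite_parabolic parabolic_subset parabolic_mult l]])
    also have "\<dots> = (\<Sum>p\<in>Par. phi chi (l' * p) * sigma p $$ (i, j))"
      by (rule sum.cong) (use l'(1) parabolic_G phi_swap in auto)
    also have "\<dots> = (\<Sum>p\<in>Par. phi chi (l' * (l * p)) * sigma (l * p) $$ (i, j))"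
      by (rule sum.reindex_bij_betw[OF finite_mat_monoid_translate(1)[OF finite_parabolic parabolic_subset parabolic_mult l], symmetric])
    also have "\<dots> = (\<Sum>p\<in>Par. phi chi p * sigma (l * p) $$ (i, j))"
      by (rule sum.cong) (use cl l'(3) parabolic_carrier in \<open>auto simp: left_mult_one_mat[OF parabolic_carrier] simp flip: assoc_mult_mat[of l' n n l n _ n]\<close>)
    also have "\<dots> = (\<Sum>p\<in>Par. phi chi p * (\<Sum>r<dt * d0. sigma l $$ (i, r) * sigma p $$ (r, j)))"
      by (rule sum.cong) (use ij sl sigma_carrier in \<open>auto simp: sigma_mult l mult_mat_index_lessThan[OF sl sigma_carrier] simp del: index_mult_mat(1)\<close>)
    also have "\<dots> = (\<Sum>r<dt * d0. \<Sum>p\<in>Par. sigma l $$ (i, r) * (phi chi p * sigma p $$ (r, j)))"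
      by (subst sum.swap) (simp add: sum_distrib_left mult_ac)
    also have "\<dots> = (sigma l * T) $$ (i, j)"
      unfolding mult_mat_index_lessThan[OF sl T ij] using ij by (simp add: T_def sum_distrib_left)
    finally show "(T * sigma l) $$ (i, j) = (sigma l * T) $$ (i, j)" .
  qed (use T sigma_carrier[OF l] in auto)
  have "\<exists>c. T = c \<cdot>\<^sub>m 1\<^sub>m (dt * d0)"
  \<comment> \<open>Lifts with one trivial Levi component turn \<open>sigma\<close> into
    \<open>kron (tau a) 1\<close> or \<open>kron 1 (pi0 b)\<close>, the two kinds of operators to be
    tested.\<close>
  proof (rule schur_scalar_kron[OF alg irrX irr0 T])
    fix a assume "a \<in> isom_group cj k (0\<^sub>m k k)"
    then obtain p where p: "p \<in> Par" "levi_X k p = a" "levi_0 k m p = 1\<^sub>m m" by (rule lift_X)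
    then show "T * kron (tau a) (1\<^sub>m d0) = kron (tau a) (1\<^sub>m d0) * T"
      using comm[OF p(1)] by (simp add: sigma_def pi0_one)
  next
    fix b assume "b \<in> isom_group cj m (gram0 k m M)"
    then obtain p where p: "p \<in> Par" "levi_X k p = 1\<^sub>m k" "levi_0 k m p = b" by (rule lift_V0)
    then show "T * kron (1\<^sub>m dt) (pi0 b) = kron (1\<^sub>m dt) (pi0 b) * T"
      using comm[OF p(1)] by (simp add: sigma_def tau_one)
  qed
  then obtain c where c: "T = c \<cdot>\<^sub>m 1\<^sub>m (dt * d0)" by blast
  have "(\<Sum>p\<in>Par. phi chi p * sigma p $$ (i, j)) = (if i = j then c else 0)" if ij: "i < dt * d0" "j < dt * d0" for i j
  proof -
    have "T $$ (i, j) = (if i = j then c else 0)" unfolding c using ij by simp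
    then show ?thesis using ij by (simp add: T_def)
  qed
  then show ?thesis by blast
qed

lemma off_parabolic_part_zero:
  fixes F :: "'e mat \<Rightarrow> 'c"
  assumes F: "\<And>u g. u \<in> unip \<Longrightarrow> g \<in> G \<Longrightarrow> F (u * g) = F g"
  shows "(\<Sum>g\<in>G - Par. phi chi g * F g) = 0"
proof -
  obtain x where x: "x \<noteq> 0" "chi (x * cj x) \<noteq> 1" using chi_nontrivial by blast
  define coset where "coset g = (\<lambda>u. u * g) ` unip" for g
  have inj: "inj_on (\<lambda>u. u * g) unip" if "g \<in> G" for g
    by (rule inj_on_mat_right_mult[OF unip_subset G_carrier[OF that] G_det[OF that]])
  have coset_eq: "coset (u * g) = coset g" if u: "u \<in> unip" and g: "g \<in> G" for u g
  proof -
    have "coset (u * g) = (\<lambda>v. v * g) ` ((\<lambda>v. v * u) ` unip)"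
      unfolding coset_def image_image using unip_carrier u G_carrier[OF g]
      by (intro image_cong) (auto simp: sq_assoc)
    then show ?thesis
      using finite_mat_monoid_translate(2)[OF finite_unip unip_subset unip_mult u] by (simp add: bij_betw_def coset_def)
  qed
  \<comment> \<open>Grouping by the value of \<open>coset\<close> is grouping by cosets. A coset
    starting outside P stays outside, as U is contained in P.\<close>
  have fiber: "{y \<in> G - Par. coset y = coset g} = coset g" if g: "g \<in> G - Par" for g
  proof (intro equalityI subsetI)
    fix y assume y: "y \<in> {y \<in> G - Par. coset y = coset g}"
    have "1\<^sub>m n * y \<in> coset y" unfolding coset_def using one_in_unip by (rule imageI)
    then show "y \<in> coset g" using y G_carrier[of y] by simp
  next
    fix y assume "y \<in> coset g"
    then obtain u where u: "u \<in> unip" "y = u * g" by (auto simp: coset_def)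
    obtain u' where u': "u' \<in> G" "u * u' = 1\<^sub>m n" "u' * u = 1\<^sub>m n" using G_obtain_inverse[OF unip_G[OF u(1)]] .
    have u'P: "u' \<in> Par" by (rule parabolic_inverse[OF unip_levi(1)[OF u(1)] G_carrier[OF u'(1)] u'(2)])
    have "u' * y = g"
      unfolding u(2) using u'(3) G_carrier[of g] G_carrier[OF u'(1)] unip_carrier[OF u(1)] g
      by (simp flip: sq_assoc)
    then have "y \<notin> Par" using parabolic_mult[OF u'P] g by auto
    moreover have "y \<in> G" using u g G_mult unip_G by blast
    ultimately show "y \<in> {y \<in> G - Par. coset y = coset g}" using coset_eq[OF u(1)] u(2) g by simp
  qed
  have zero: "(\<Sum>y\<in>coset g. phi chi y * F y) = 0" if g: "g \<in> G - Par" for g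
  proof -
    have gG: "g \<in> G" using g by simp
    have "(\<Sum>y\<in>coset g. phi chi y * F y) = (\<Sum>u\<in>unip. phi chi (u * g) * F (u * g))"
      unfolding coset_def by (simp add: sum.reindex[OF inj[OF gG]])
    \<comment> \<open>\<open>F\<close> is invariant under U on the left, while the vanishing sum has
      \<open>u\<close> on the right of \<open>g\<close>; \<open>phi_swap\<close> reconciles the
      two.\<close>
    also have "\<dots> = (\<Sum>u\<in>unip. phi chi (g * u) * F g)"
      by (rule sum.cong) (simp_all add: F gG phi_swap[OF unip_G gG])
    also have "\<dots> = (\<Sum>u\<in>unip. phi chi (g * u)) * F g" by (simp add: sum_distrib_right)
    also have "\<dots> = 0" using phi_sum_unip[OF chi x gG] g by simp
    finally show ?thesis .
  qed
  have "(\<Sum>g\<in>G - Par. phi chi g * F g)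
    = (\<Sum>C\<in>coset ` (G - Par). \<Sum>y\<in>{y \<in> G - Par. coset y = C}. phi chi y * F y)"
    using finite_G by (intro sum.group[symmetric]) auto
  also have "\<dots> = 0" using fiber zero by (intro sum.neutral) auto
  finally show ?thesis .
qed

text \<open>The group acts by right translation, but \<open>f\<close> transforms under P on the
  left. Conjugating the summation variable by \<open>h\<close> moves it to the left; this is done as
  two translations with \<open>phi_swap\<close> in between.\<close>

lemma J_op_index:
  assumes h: "h \<in> G" and i: "i < d"
  shows "J_op cj eps n M sq chi d f h $ i = inverse (half_size cj n M sq) * (\<Sum>g\<in>G. phi chi g * f (g * h) $ i)"
proof -
  obtain h' where h': "h' \<in> G" "h * h' = 1\<^sub>m n" "h' * h = 1\<^sub>m n" using G_obtain_inverse[OF h] .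
  note c = G_carrier[OF h] G_carrier[OF h'(1)]
  have "(\<Sum>g \<in> {g \<in> isom_group0 cj eps n M. det (1\<^sub>m n + g) \<noteq> 0}. chi (det (1\<^sub>m n + g)) * f (h * g) $ i)
    = (\<Sum>g\<in>G. phi chi g * f (h * g) $ i)"
    using finite_G by (intro sum.mono_neutral_cong_left) (auto simp: isom_group0_iff phi_def)
  also have "\<dots> = (\<Sum>g\<in>G. phi chi (h' * (h * g)) * f (h * g) $ i)"
    by (rule sum.cong) (use c h'(3) G_carrier in \<open>auto simp: left_mult_one_mat[OF G_carrier] simp flip: assoc_mult_mat[of h' n n h n _ n]\<close>)
  also have "\<dots> = (\<Sum>g\<in>G. phi chi (h' * g) * f g $ i)"
    by (rule sum.reindex_bij_betw[OF finite_mat_monoid_translate(1)[OF finite_G G_subset G_mult h]])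
  also have "\<dots> = (\<Sum>g\<in>G. phi chi (g * h') * f g $ i)"
    by (rule sum.cong) (simp_all add: phi_swap[OF h'(1)])
  also have "\<dots> = (\<Sum>g\<in>G. phi chi (g * h * h') * f (g * h) $ i)"
    by (rule sum.reindex_bij_betw[OF finite_mat_monoid_translate(2)[OF finite_G G_subset G_mult h], symmetric])
  also have "\<dots> = (\<Sum>g\<in>G. phi chi g * f (g * h) $ i)"
    by (rule sum.cong) (use c h'(2) G_carrier in \<open>auto simp: sq_assoc right_mult_one_mat[OF G_carrier]\<close>)
  finally show ?thesis using i by (simp add: J_op_def)
qed

theorem J_op_scalar:
  "\<exists>c. \<forall>f \<in> ind_space cj k m n M dt tau d0 pi0. \<forall>h \<in> G. J_op cj eps n M sq chi (dt * d0) f h = c \<cdot>\<^sub>v f h"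
proof -
  obtain c where c: "\<And>i j. i < dt * d0 \<Longrightarrow> j < dt * d0 \<Longrightarrow>
      (\<Sum>p\<in>Par. phi chi p * sigma p $$ (i, j)) = (if i = j then c else 0)"
    using parabolic_part_scalar by blast
  have "J_op cj eps n M sq chi (dt * d0) f h = (inverse (half_size cj n M sq) * c) \<cdot>\<^sub>v f h"
    if f: "f \<in> ind_space cj k m n M dt tau d0 pi0" and h: "h \<in> G" for f h
  proof (rule eq_vecI)
    have fc: "f g \<in> carrier_vec (dt * d0)" if "g \<in> G" for g using f that by (simp add: ind_space_def)
    have fP: "f (p * g) = sigma p *\<^sub>v f g" if "p \<in> Par" "g \<in> G" for p g
      using f that by (simp add: ind_space_def sigma_def)
    show "dim_vec (J_op cj eps n M sq chi (dt * d0) f h) = dim_vec ((inverse (half_size cj n M sq) * c) \<cdot>\<^sub>v f h)"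
      using fc[OF h] by (simp add: J_op_def)
    fix i assume "i < dim_vec ((inverse (half_size cj n M sq) * c) \<cdot>\<^sub>v f h)"
    then have i: "i < dt * d0" using fc[OF h] by simp
    have inv: "f (u * g * h) $ i = f (g * h) $ i" if u: "u \<in> unip" and g: "g \<in> G" for u g
    proof -
      \<comment> \<open>Both Levi components of \<open>u\<close> are trivial, which makes
        \<open>f\<close> left invariant under U.\<close>
      have "sigma u = 1\<^sub>m (dt * d0)" by (simp add: sigma_def unip_levi[OF u] tau_one pi0_one kron_one)
      then have "f (u * (g * h)) = f (g * h)"
        using fP[OF unip_levi(1)[OF u] G_mult[OF g h]] fc[OF G_mult[OF g h]] by simp
      then show ?thesis using unip_carrier[OF u] G_carrier[OF g] G_carrier[OF h] by (simp add: sq_assoc)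
    qed
    have "(\<Sum>g\<in>G. phi chi g * f (g * h) $ i)
      = (\<Sum>p\<in>Par. phi chi p * f (p * h) $ i) + (\<Sum>g\<in>G - Par. phi chi g * f (g * h) $ i)"
      using sum.subset_diff[of Par G "\<lambda>g. phi chi g * f (g * h) $ i"] finite_G parabolic_G by (auto simp: add.commute)
    also have "(\<Sum>g\<in>G - Par. phi chi g * f (g * h) $ i) = 0"
      by (rule off_parabolic_part_zero) (rule inv)
    \<comment> \<open>Over P, the covariance of \<open>f\<close> expresses the sum through the
      matrix that \<open>parabolic_part_scalar\<close> identifies as \<open>c\<close> times the
      identity.\<close>
    also have "(\<Sum>p\<in>Par. phi chi p * f (p * h) $ i)
      = (\<Sum>p\<in>Par. \<Sum>j<dt * d0. phi chi p * sigma p $$ (i, j) * f h $ j)"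
      by (rule sum.cong) (simp_all add: fP h mult_vec_index[OF sigma_carrier fc[OF h] i] sum_distrib_left mult.assoc del: index_mult_mat_vec)
    also have "\<dots> = (\<Sum>j<dt * d0. (\<Sum>p\<in>Par. phi chi p * sigma p $$ (i, j)) * f h $ j)"
      by (subst sum.swap) (simp add: sum_distrib_right)
    also have "\<dots> = (\<Sum>j<dt * d0. if j = i then c * f h $ j else 0)"
      using i c by (intro sum.cong) auto
    also have "\<dots> = c * f h $ i" using i by simp
    finally show "J_op cj eps n M sq chi (dt * d0) f h $ i = ((inverse (half_size cj n M sq) * c) \<cdot>\<^sub>v f h) $ i"
      using i fc[OF h] by (simp add: J_op_index[OF h])
  qed
  then show ?thesis by blast
qed

end

theorem mainTheorem7:
  fixes cj :: "'e::{field,finite} \<Rightarrow> 'e"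
    and eps :: 'e
    and sq :: "'c::field"
    and chi :: "'e \<Rightarrow> 'c"
    and k m n :: nat
    and M :: "'e mat"
    and dt d0 :: nat
    and tau pi0 :: "'e mat \<Rightarrow> 'c mat"
  assumes "galois_setup cj"
    and "alg_closed TYPE('c)"
    and "of_nat (qF cj) \<noteq> (0::'c)"
    and "sq ^ 2 = of_nat (qF cj)"
    and "parabolic_setup cj eps k m n M"
    and "irrep m (isom_group cj m (gram0 k m M)) d0 pi0"
    and "irrep k (isom_group cj k (0\<^sub>m k k)) dt tau"
    and "character chi"
    and "\<exists>x. x \<noteq> 0 \<and> chi (x * cj x) \<noteq> 1"
  shows "\<exists>c::'c. \<forall>f \<in> ind_space cj k m n M dt tau d0 pi0. \<forall>h \<in> isom_group cj n M.
           J_op cj eps n M sq chi (dt * d0) f h = c \<cdot>\<^sub>v f h"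
proof -
  interpret induced_setup cj eps k m n M dt d0 tau pi0 chi
    by unfold_locales (use assms in blast)+
  show ?thesis by (rule J_op_scalar)
qed

end
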